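(* Let $T$ and $P$ be as in the context, and let $\lambda\in\mathrm{res}^*(P)$ and $n\ge1$. Every $\lambda$-polyharmonic function $f:T\to\mathbb{C}$ of order $n$ has an integral representation $$f(x)=\sum_{r=0}^{n-1}\int_{\partial T}K^{(r)}(x,\xi\mid\lambda)\,d\nu_r(\xi),\qquad x\in T,$$ where the complex distributions $\nu_0,\dots,\nu_{n-1}$ are uniquely determined by $f$. Conversely, every function having such a representation is $\lambda$-polyharmonic of order $n$.
   Context: $T$ is a countable tree without leaves; degrees may be countably infinite. $P$ is stochastic with $p(x,y)>0$ iff $x\sim y$, and $Pf(x)=\sum_y p(x,y)f(y)$ (absolutely convergent). A function $f$ is $\lambda$-polyharmonic of order $n$ if $(\lambda I-P)^nf=0$, where all successive applications of $P$ are defined by absolutely convergent sums. Fix a root $o$, and let $\mathsf m(x)=\prod_{i=1}^k p(x_{i-1},x_i)/p(x_i,x_{i-1})$ along $\pi(o,x)=[x_0,\dots,x_k]$. $P$ is a bounded self-adjoint operator on $\ell^2(T,\mathsf m)$, and $\mathrm{res}(P)=\mathbb{C}\setminus\mathrm{spec}(P)$. For $\lambda\in\mathrm{res}(P)$, $G(x,y\mid\lambda)=((\lambda I-P)^{-1}\mathbf 1_y)(x)$. $\mathrm{res}^*(P)=\{\lambda\in\mathrm{res}(P):G(x,x\mid\lambda)\ne0\ \forall x\}$. $\partial T$ is the set of ends. $x\wedge w$ is the last common vertex of $\pi(o,x)$ and $\pi(o,w)$. $K(x,\xi\mid\lambda)=G(x,x\wedge\xi\mid\lambda)/G(o,x\wedge\xi\mid\lambda)$,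 and $K^{(r)}$ is its $r$-th derivative in $\lambda$. $x^-$ is the neighbour of $x\neq o$ closer to $o$. $\partial T_x$ is the set of ends whose ray from $o$ passes through $x$. A complex distribution is $\nu:\{\partial T_x\}\to\mathbb{C}$ with $\nu(\partial T_x)=\sum_{y^-=x}\nu(\partial T_y)$, absolutely convergent. Integral of a locally constant $\varphi$ (constant value $\varphi_x$ on $\partial T_x\setminus\bigcup_{y\in\tau,y^-=x}\partial T_y$ for each $x$ in a finite subtree $\tau\ni o$): $\int\varphi\,d\nu=\sum_{x\in\tau}\varphi_x(\nu(\partial T_x)-\sum_{y\in\tau,y^-=x}\nu(\partial T_y))$. For fixed $x$, $\xi\mapsto K^{(r)}(x,\xi\mid\lambda)$ is locally constant, with $\tau=\pi(o,x)$. *)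

theory Defs
  imports "HOL-Analysis.Analysis"
begin

definition is_walk :: "('v \<Rightarrow> 'v \<Rightarrow> bool) \<Rightarrow> 'v list \<Rightarrow> bool" where
  "is_walk adj xs \<longleftrightarrow> xs \<noteq> [] \<and> (\<forall>i. Suc i < length xs \<longrightarrow> adj (xs ! i) (xs ! Suc i))"

definition is_simple_path :: "('v \<Rightarrow> 'v \<Rightarrow> bool) \<Rightarrow> 'v \<Rightarrow> 'v \<Rightarrow> 'v list \<Rightarrow> bool" where
  "is_simple_path adj x y xs \<longleftrightarrow> is_walk adj xs \<and> distinct xs \<and> hd xs = x \<and> last xs = y"

definition is_tree :: "('v \<Rightarrow> 'v \<Rightarrow> bool) \<Rightarrow> bool" where
  "is_tree adj \<longleftrightarrow> (\<forall>x y. adj x y \<longrightarrow> adj y x) \<and> (\<forall>x. \<not> adj x x) \<and>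
     (\<forall>x y. \<exists>!xs. is_simple_path adj x y xs)"

definition no_leaves :: "('v \<Rightarrow> 'v \<Rightarrow> bool) \<Rightarrow> bool" where
  "no_leaves adj \<longleftrightarrow> (\<forall>x. \<exists>y z. adj x y \<and> adj x z \<and> y \<noteq> z)"

definition geod :: "('v \<Rightarrow> 'v \<Rightarrow> bool) \<Rightarrow> 'v \<Rightarrow> 'v \<Rightarrow> 'v list" where
  "geod adj rt x = (THE xs. is_simple_path adj rt x xs)"

definition parent :: "('v \<Rightarrow> 'v \<Rightarrow> bool) \<Rightarrow> 'v \<Rightarrow> 'v \<Rightarrow> 'v" where
  "parent adj rt x = (THE y. adj y x \<and> y \<in> set (geod adj rt x))"

definition children :: "('v \<Rightarrow> 'v \<Rightarrow> bool) \<Rightarrow> 'v \<Rightarrow> 'v \<Rightarrow> 'v set" where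
  "children adj rt x = {y. y \<noteq> rt \<and> parent adj rt y = x}"

text \<open>Ends are represented by the geodesic rays starting at the root \<open>rt\<close>.\<close>
definition ends :: "('v \<Rightarrow> 'v \<Rightarrow> bool) \<Rightarrow> 'v \<Rightarrow> (nat \<Rightarrow> 'v) set" where
  "ends adj rt = {\<xi>. \<xi> 0 = rt \<and> (\<forall>n. adj (\<xi> n) (\<xi> (Suc n))) \<and> inj \<xi>}"

definition bdy :: "('v \<Rightarrow> 'v \<Rightarrow> bool) \<Rightarrow> 'v \<Rightarrow> 'v \<Rightarrow> (nat \<Rightarrow> 'v) set" where
  "bdy adj rt x = {\<xi> \<in> ends adj rt. \<exists>n. \<xi> n = x}"

definition confl :: "('v \<Rightarrow> 'v \<Rightarrow> bool) \<Rightarrow> 'v \<Rightarrow> 'v \<Rightarrow> (nat \<Rightarrow> 'v) \<Rightarrow> 'v" where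
  "confl adj rt x \<xi> = \<xi> (GREATEST k. \<xi> k \<in> set (geod adj rt x))"

definition stochastic :: "('v \<Rightarrow> 'v \<Rightarrow> bool) \<Rightarrow> ('v \<Rightarrow> 'v \<Rightarrow> real) \<Rightarrow> bool" where
  "stochastic adj p \<longleftrightarrow> (\<forall>x y. p x y \<ge> 0) \<and> (\<forall>x y. p x y > 0 \<longleftrightarrow> adj x y) \<and>
     (\<forall>x. (p x has_sum 1) UNIV)"

definition Pop :: "('v \<Rightarrow> 'v \<Rightarrow> real) \<Rightarrow> ('v \<Rightarrow> complex) \<Rightarrow> 'v \<Rightarrow> complex" where
  "Pop p f x = (\<Sum>\<^sub>\<infinity>y. complex_of_real (p x y) * f y)"

definition Pdefined :: "('v \<Rightarrow> 'v \<Rightarrow> real) \<Rightarrow> ('v \<Rightarrow> complex) \<Rightarrow> bool" where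
  "Pdefined p f \<longleftrightarrow> (\<forall>x. (\<lambda>y. norm (complex_of_real (p x y) * f y)) summable_on UNIV)"

definition Lop :: "('v \<Rightarrow> 'v \<Rightarrow> real) \<Rightarrow> complex \<Rightarrow> ('v \<Rightarrow> complex) \<Rightarrow> 'v \<Rightarrow> complex" where
  "Lop p lam f x = lam * f x - Pop p f x"

definition polyharmonic :: "('v \<Rightarrow> 'v \<Rightarrow> real) \<Rightarrow> complex \<Rightarrow> nat \<Rightarrow> ('v \<Rightarrow> complex) \<Rightarrow> bool" where
  "polyharmonic p lam n f \<longleftrightarrow> (\<forall>k<n. Pdefined p ((Lop p lam ^^ k) f)) \<and> (Lop p lam ^^ n) f = (\<lambda>_. 0)"

definition mfun :: "('v \<Rightarrow> 'v \<Rightarrow> bool) \<Rightarrow> ('v \<Rightarrow> 'v \<Rightarrow> real) \<Rightarrow> 'v \<Rightarrow> 'v \<Rightarrow> real" where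
  "mfun adj p rt x = (let xs = geod adj rt x in
      prod_list (map (\<lambda>(a, b). p a b / p b a) (zip xs (tl xs))))"

definition l2m :: "('v \<Rightarrow> 'v \<Rightarrow> bool) \<Rightarrow> ('v \<Rightarrow> 'v \<Rightarrow> real) \<Rightarrow> 'v \<Rightarrow> ('v \<Rightarrow> complex) set" where
  "l2m adj p rt = {f. (\<lambda>x. (cmod (f x))\<^sup>2 * mfun adj p rt x) summable_on UNIV}"

definition resP :: "('v \<Rightarrow> 'v \<Rightarrow> bool) \<Rightarrow> ('v \<Rightarrow> 'v \<Rightarrow> real) \<Rightarrow> 'v \<Rightarrow> complex set" where
  "resP adj p rt = {lam. \<forall>g \<in> l2m adj p rt. \<exists>!f. f \<in> l2m adj p rt \<and> Lop p lam f = g}"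

definition green :: "('v \<Rightarrow> 'v \<Rightarrow> bool) \<Rightarrow> ('v \<Rightarrow> 'v \<Rightarrow> real) \<Rightarrow> 'v \<Rightarrow> complex \<Rightarrow> 'v \<Rightarrow> 'v \<Rightarrow> complex" where
  "green adj p rt lam x y =
     (THE f. f \<in> l2m adj p rt \<and> Lop p lam f = (\<lambda>z. if z = y then 1 else 0)) x"

definition resP_star :: "('v \<Rightarrow> 'v \<Rightarrow> bool) \<Rightarrow> ('v \<Rightarrow> 'v \<Rightarrow> real) \<Rightarrow> 'v \<Rightarrow> complex set" where
  "resP_star adj p rt = {lam \<in> resP adj p rt. \<forall>x. green adj p rt lam x x \<noteq> 0}"

definition Kern :: "('v \<Rightarrow> 'v \<Rightarrow> bool) \<Rightarrow> ('v \<Rightarrow> 'v \<Rightarrow> real) \<Rightarrow> 'v \<Rightarrow> complex \<Rightarrow> 'v \<Rightarrow> (nat \<Rightarrow> 'v) \<Rightarrow> complex" where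
  "Kern adj p rt lam x \<xi> = green adj p rt lam x (confl adj rt x \<xi>) / green adj p rt lam rt (confl adj rt x \<xi>)"

definition Kderiv :: "('v \<Rightarrow> 'v \<Rightarrow> bool) \<Rightarrow> ('v \<Rightarrow> 'v \<Rightarrow> real) \<Rightarrow> 'v \<Rightarrow> nat \<Rightarrow> complex \<Rightarrow> 'v \<Rightarrow> (nat \<Rightarrow> 'v) \<Rightarrow> complex" where
  "Kderiv adj p rt r lam x \<xi> = (deriv ^^ r) (\<lambda>\<mu>. Kern adj p rt \<mu> x \<xi>) lam"

text \<open>A complex distribution, given by its values \<open>\<nu> x = \<nu>(\<partial>T_x)\<close>.\<close>
definition cdist :: "('v \<Rightarrow> 'v \<Rightarrow> bool) \<Rightarrow> 'v \<Rightarrow> ('v \<Rightarrow> complex) \<Rightarrow> bool" where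
  "cdist adj rt \<nu> \<longleftrightarrow> (\<forall>x. (\<lambda>y. norm (\<nu> y)) summable_on children adj rt x \<and> (\<nu> has_sum \<nu> x) (children adj rt x))"

text \<open>Integral of a function \<open>\<phi>\<close> locally constant w.r.t. the finite subtree \<open>\<tau>\<close>: the value
  \<open>\<phi>_x\<close> is taken at a point of \<open>\<partial>T_x\<close> minus the \<open>\<partial>T_y\<close>, \<open>y \<in> \<tau>\<close>, \<open>y\<^sup>- = x\<close> (if that set is
  empty, the corresponding weight vanishes).\<close>
definition loc_integral :: "('v \<Rightarrow> 'v \<Rightarrow> bool) \<Rightarrow> 'v \<Rightarrow> 'v set \<Rightarrow> ((nat \<Rightarrow> 'v) \<Rightarrow> complex) \<Rightarrow> ('v \<Rightarrow> complex) \<Rightarrow> complex" where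
  "loc_integral adj rt \<tau> \<phi> \<nu> =
     (\<Sum>x\<in>\<tau>. \<phi> (SOME \<xi>. \<xi> \<in> bdy adj rt x - (\<Union>y \<in> \<tau> \<inter> children adj rt x. bdy adj rt y)) *
        (\<nu> x - (\<Sum>y \<in> \<tau> \<inter> children adj rt x. \<nu> y)))"

definition Krep :: "('v \<Rightarrow> 'v \<Rightarrow> bool) \<Rightarrow> ('v \<Rightarrow> 'v \<Rightarrow> real) \<Rightarrow> 'v \<Rightarrow> complex \<Rightarrow> nat \<Rightarrow> (nat \<Rightarrow> 'v \<Rightarrow> complex) \<Rightarrow> 'v \<Rightarrow> complex" where
  "Krep adj p rt lam n \<nu> x =
     (\<Sum>r<n. loc_integral adj rt (set (geod adj rt x)) (Kderiv adj p rt r lam x) (\<nu> r))"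

end

theory Submission
  imports Defs "HOL-Complex_Analysis.Cauchy_Integral_Formula"
begin

text \<open>
  Write \<open>k\<^sub>v = G(\<cdot>, v) / G(o, v)\<close>. Since \<open>(\<lambda>I - P) k\<^sub>v = 1\<^sub>v / G(o, v)\<close>, the difference
  \<open>D\<^sub>v = k\<^sub>v - k\<^sub>w\<close>, with \<open>w\<close> the parent of \<open>v\<close>, vanishes outside the branch at \<open>v\<close> and satisfies
  \<open>p(w, v) D\<^sub>v(v) = 1 / G(o, w)\<close>. Summation by parts along the geodesic from \<open>o\<close> to \<open>x\<close> turns
  the integral of the \<open>r\<close>-th derivative of the kernel into the triangular sum of \<open>D\<^sub>v\<^sup>(\<^sup>r\<^sup>)(x) \<nu>(v)\<close>
  over the vertices \<open>v\<close> of the geodesic. Applying \<open>\<lambda>I - P\<close> yields \<open>-r\<close> times the same sum for \<open>r - 1\<close>,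
  plus the \<open>r\<close>-th derivative of \<open>1 / G(o, x)\<close> times the defect \<open>\<nu>(x) - \<Sum>\<nu>(y)\<close> over the children
  \<open>y\<close> of \<open>x\<close>. For \<open>r = 0\<close>, triangularity gives existence and uniqueness of \<open>\<nu>\<close>, and harmonicity
  is the same as vanishing of the defect; the general case follows by induction on the order.
  Derivatives in \<open>\<lambda>\<close> are controlled by the Neumann series of the resolvent in \<open>\<ell>\<^sup>2\<close>.
\<close>

section \<open>The Banach space of square summable functions\<close>

definition sq_summable :: "('v \<Rightarrow> complex) \<Rightarrow> bool" where
  "sq_summable f \<longleftrightarrow> (\<lambda>x. (cmod (f x))\<^sup>2) summable_on UNIV"

definition l2norm :: "('v \<Rightarrow> complex) \<Rightarrow> real" where
  "l2norm f = sqrt (\<Sum>\<^sub>\<infinity>x. (cmod (f x))\<^sup>2)"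

lemma L2_set_le_l2norm:
  assumes "sq_summable f" "finite F"
  shows "L2_set (\<lambda>x. cmod (f x)) F \<le> l2norm f"
  using assms unfolding L2_set_def l2norm_def sq_summable_def
  by (intro real_sqrt_le_mono finite_sum_le_infsum) auto

lemma sum_le_square_if_L2_set_le:
  assumes "L2_set (\<lambda>x. cmod (f x)) F \<le> B"
  shows "(\<Sum>x\<in>F. (cmod (f x))\<^sup>2) \<le> B\<^sup>2"
proof -
  have "(L2_set (\<lambda>x. cmod (f x)) F)\<^sup>2 \<le> B\<^sup>2"
    using assms by (intro power_mono) (auto simp: L2_set_nonneg)
  then show ?thesis
    by (simp add: L2_set_def sum_nonneg)
qed

lemma sq_summableI:
  assumes "\<And>F. finite F \<Longrightarrow> L2_set (\<lambda>x. cmod (f x)) F \<le> B"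
  shows "sq_summable f"
  unfolding sq_summable_def
proof (rule nonneg_bdd_above_summable_on)
  show "bdd_above (sum (\<lambda>x. (cmod (f x))\<^sup>2) ` {F. F \<subseteq> UNIV \<and> finite F})"
    using assms by (intro bdd_aboveI[of _ "B\<^sup>2"]) (auto intro!: sum_le_square_if_L2_set_le)
qed auto

text \<open>The infinite sum is the supremum of its finite partial sums. In this form the Minkowski
  inequality for \<open>L2_set\<close> carries over to the infinite norm.\<close>

lemma l2norm_leI:
  assumes "\<And>F. finite F \<Longrightarrow> L2_set (\<lambda>x. cmod (f x)) F \<le> B"
  shows "l2norm f \<le> B"
proof -
  have "0 \<le> B"
    using assms[of "{}"] by simp
  have "(\<Sum>\<^sub>\<infinity>x. (cmod (f x))\<^sup>2) \<le> B\<^sup>2"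
    using sq_summableI[of f B] assms
    by (intro infsum_le_finite_sums) (auto simp: sq_summable_def intro!: sum_le_square_if_L2_set_le)
  then show ?thesis
    unfolding l2norm_def using \<open>0 \<le> B\<close> by (simp add: real_le_lsqrt)
qed

lemma L2_set_add_le:
  assumes "sq_summable f" "sq_summable g" "finite F"
  shows "L2_set (\<lambda>x. cmod (f x + g x)) F \<le> l2norm f + l2norm g"
proof -
  have "L2_set (\<lambda>x. cmod (f x + g x)) F \<le> L2_set (\<lambda>x. cmod (f x) + cmod (g x)) F"
    by (intro L2_set_mono) (auto simp: norm_triangle_ineq)
  also have "\<dots> \<le> L2_set (\<lambda>x. cmod (f x)) F + L2_set (\<lambda>x. cmod (g x)) F"
    by (rule L2_set_triangle_ineq)
  also have "\<dots> \<le> l2norm f + l2norm g"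
    using assms by (intro add_mono L2_set_le_l2norm)
  finally show ?thesis .
qed

lemma L2_set_cmult:
  "L2_set (\<lambda>x. cmod (c * f x)) F = cmod c * L2_set (\<lambda>x. cmod (f x)) F"
  by (simp add: norm_mult L2_set_right_distrib)

lemma sq_summable_add: "sq_summable f \<Longrightarrow> sq_summable g \<Longrightarrow> sq_summable (\<lambda>x. f x + g x)"
  by (rule sq_summableI[OF L2_set_add_le])

lemma sq_summable_cmult: "sq_summable f \<Longrightarrow> sq_summable (\<lambda>x. c * f x)"
  by (rule sq_summableI[of _ "cmod c * l2norm f"])
    (simp add: L2_set_cmult L2_set_le_l2norm mult_left_mono)

lemma sq_summable_zero: "sq_summable (\<lambda>_. 0)"
  by (simp add: sq_summable_def)

lemma l2norm_cmult: "sq_summable f \<Longrightarrow> l2norm (\<lambda>x. c * f x) = cmod c * l2norm f"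
  unfolding l2norm_def
  by (simp add: norm_mult power_mult_distrib infsum_cmult_right' real_sqrt_mult)

lemma l2norm_triangle:
  "sq_summable f \<Longrightarrow> sq_summable g \<Longrightarrow> l2norm (\<lambda>x. f x + g x) \<le> l2norm f + l2norm g"
  by (rule l2norm_leI[OF L2_set_add_le])

lemma norm_le_l2norm: "sq_summable f \<Longrightarrow> cmod (f x) \<le> l2norm f"
  using L2_set_le_l2norm[of f "{x}"] by simp

text \<open>A separate type makes the class \<open>banach\<close> available, so that operator norms,
  convergent series of vectors and Baire's theorem can be applied to square summable
  functions.\<close>

typedef 'v ell2 = "{f :: 'v \<Rightarrow> complex. sq_summable f}"
  morphisms apply_ell2 Abs_ell2
  using sq_summable_zero by blast

setup_lifting type_definition_ell2

instantiation ell2 :: (type) real_vector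
begin

lift_definition zero_ell2 :: "'a ell2" is "\<lambda>_. 0"
  by (rule sq_summable_zero)

lift_definition plus_ell2 :: "'a ell2 \<Rightarrow> 'a ell2 \<Rightarrow> 'a ell2" is "\<lambda>f g x. f x + g x"
  by (rule sq_summable_add)

lift_definition uminus_ell2 :: "'a ell2 \<Rightarrow> 'a ell2" is "\<lambda>f x. - f x"
  using sq_summable_cmult[of _ "-1"] by simp

lift_definition minus_ell2 :: "'a ell2 \<Rightarrow> 'a ell2 \<Rightarrow> 'a ell2" is "\<lambda>f g x. f x - g x"
  using sq_summable_add sq_summable_cmult[of _ "-1"] by fastforce

lift_definition scaleR_ell2 :: "real \<Rightarrow> 'a ell2 \<Rightarrow> 'a ell2" is "\<lambda>r f x. complex_of_real r * f x"
  by (rule sq_summable_cmult)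

instance
  by standard (transfer; auto simp: algebra_simps fun_eq_iff)+

end

instantiation ell2 :: (type) real_normed_vector
begin

lift_definition norm_ell2 :: "'a ell2 \<Rightarrow> real" is l2norm .

definition dist_ell2 :: "'a ell2 \<Rightarrow> 'a ell2 \<Rightarrow> real" where
  "dist_ell2 f g = norm (f - g)"

definition sgn_ell2 :: "'a ell2 \<Rightarrow> 'a ell2" where
  "sgn_ell2 f = f /\<^sub>R norm f"

definition uniformity_ell2 :: "('a ell2 \<times> 'a ell2) filter" where
  "uniformity_ell2 = (INF e\<in>{0<..}. principal {(x, y). dist x y < e})"

definition open_ell2 :: "'a ell2 set \<Rightarrow> bool" where
  "open_ell2 U = (\<forall>x\<in>U. eventually (\<lambda>(x', y). x' = x \<longrightarrow> y \<in> U) uniformity)"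

instance
proof
  fix f g :: "'a ell2" and r :: real
  show "(norm f = 0) = (f = 0)"
  proof
    show "norm f = 0 \<Longrightarrow> f = 0"
    proof transfer
      fix f :: "'a \<Rightarrow> complex"
      assume "sq_summable f" "l2norm f = 0"
      then have "cmod (f x) \<le> 0" for x
        using norm_le_l2norm[of f x] by simp
      then show "f = (\<lambda>_. 0)"
        by auto
    qed
    show "f = 0 \<Longrightarrow> norm f = 0"
      by transfer (simp add: l2norm_def)
  qed
  show "norm (f + g) \<le> norm f + norm g"
    by transfer (rule l2norm_triangle)
  show "norm (r *\<^sub>R f) = \<bar>r\<bar> * norm f"
    by transfer (simp add: l2norm_cmult)
  show "dist f g = norm (f - g)"
    by (rule dist_ell2_def)
  show "sgn f = f /\<^sub>R norm f"
    by (rule sgn_ell2_def)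
  show "uniformity = (INF e\<in>{0<..}. principal {(x, y :: 'a ell2). dist x y < e})"
    by (rule uniformity_ell2_def)
  show "open U = (\<forall>x\<in>U. eventually (\<lambda>(x', y). x' = x \<longrightarrow> y \<in> U) uniformity)" for U :: "'a ell2 set"
    by (rule open_ell2_def)
qed

end

text \<open>The class instances provide real scalars; the complex spectral parameter acts through
  this operation.\<close>

lift_definition scaleC_ell2 :: "complex \<Rightarrow> 'v ell2 \<Rightarrow> 'v ell2" is "\<lambda>c f x. c * f x"
  by (rule sq_summable_cmult)

lemma norm_scaleC_ell2: "norm (scaleC_ell2 c f) = cmod c * norm f"
  by transfer (rule l2norm_cmult)

lemma apply_ell2_simps:
  "apply_ell2 0 x = 0"
  "apply_ell2 (f + g) x = apply_ell2 f x + apply_ell2 g x"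
  "apply_ell2 (f - g) x = apply_ell2 f x - apply_ell2 g x"
  "apply_ell2 (scaleC_ell2 c f) x = c * apply_ell2 f x"
  "apply_ell2 (r *\<^sub>R f) x = complex_of_real r * apply_ell2 f x"
  by (transfer; simp)+

lemma ell2_eqI: "(\<And>x. apply_ell2 f x = apply_ell2 g x) \<Longrightarrow> f = g"
  by transfer auto

lemma scaleC_ell2_simps:
  "scaleC_ell2 1 f = f"
  "scaleC_ell2 a (scaleC_ell2 b f) = scaleC_ell2 (a * b) f"
  "scaleC_ell2 a (f - g) = scaleC_ell2 a f - scaleC_ell2 a g"
  "scaleC_ell2 (a - b) f = scaleC_ell2 a f - scaleC_ell2 b f"
  by (auto intro!: ell2_eqI simp: apply_ell2_simps algebra_simps)

lemma norm_apply_ell2_le: "cmod (apply_ell2 f x) \<le> norm f"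
  by transfer (rule norm_le_l2norm)

lemma norm_ell2_leI:
  "(\<And>F. finite F \<Longrightarrow> L2_set (\<lambda>x. cmod (apply_ell2 f x)) F \<le> B) \<Longrightarrow> norm f \<le> B"
  by transfer (rule l2norm_leI)

lemma L2_set_le_norm_ell2:
  "finite F \<Longrightarrow> L2_set (\<lambda>x. cmod (apply_ell2 f x)) F \<le> norm f"
  by transfer (rule L2_set_le_l2norm)

text \<open>Tests a norm bound on finitely many coordinates at a time. Sublevel sets of a norm
  thereby become intersections of sets given by continuous functions, hence closed.\<close>

lemma norm_ell2_le_iff:
  "norm f \<le> B \<longleftrightarrow> (\<forall>F. finite F \<longrightarrow> L2_set (\<lambda>x. cmod (apply_ell2 f x)) F \<le> B)"
proof
  show "norm f \<le> B \<Longrightarrow> \<forall>F. finite F \<longrightarrow> L2_set (\<lambda>x. cmod (apply_ell2 f x)) F \<le> B"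
    using L2_set_le_norm_ell2[of _ f] by fastforce
qed (simp add: norm_ell2_leI)

lemma bounded_linear_apply_ell2: "bounded_linear (\<lambda>f. apply_ell2 f x)"
  by (rule bounded_linear_intro[of _ 1])
    (auto simp: apply_ell2_simps norm_apply_ell2_le scaleR_conv_of_real)

lemma bounded_linear_scaleC_ell2: "bounded_linear (scaleC_ell2 c)"
  by (rule bounded_linear_intro[of _ "cmod c"])
    (auto simp: norm_scaleC_ell2 apply_ell2_simps algebra_simps intro!: ell2_eqI)

instance ell2 :: (type) banach
proof
  fix X :: "nat \<Rightarrow> 'a ell2"
  assume X: "Cauchy X"
  have "Cauchy (\<lambda>n. apply_ell2 (X n) x)" for x
    using bounded_linear.Cauchy[OF bounded_linear_apply_ell2 X] .
  then have "\<exists>l. (\<lambda>n. apply_ell2 (X n) x) \<longlonglongrightarrow> l" for x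
    using Cauchy_convergent_iff convergent_def by blast
  then obtain l where l: "\<And>x. (\<lambda>n. apply_ell2 (X n) x) \<longlonglongrightarrow> l x"
    by metis
  \<comment> \<open>The Cauchy estimate is passed to the coordinatewise limit \<open>l\<close> on a
    fixed finite set, with a bound independent of that set.\<close>
  have close: "L2_set (\<lambda>x. cmod (apply_ell2 (X m) x - l x)) F \<le> e"
    if "\<And>n. n \<ge> N \<Longrightarrow> norm (X m - X n) < e" "finite F" for m N e F
  proof (rule LIMSEQ_le_const2)
    show "(\<lambda>n. L2_set (\<lambda>x. cmod (apply_ell2 (X m) x - apply_ell2 (X n) x)) F)
        \<longlonglongrightarrow> L2_set (\<lambda>x. cmod (apply_ell2 (X m) x - l x)) F"
      unfolding L2_set_def by (intro tendsto_intros l)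
    have "L2_set (\<lambda>x. cmod (apply_ell2 (X m) x - apply_ell2 (X n) x)) F \<le> e" if "n \<ge> N" for n
      using L2_set_le_norm_ell2[OF \<open>finite F\<close>, of "X m - X n"] \<open>\<And>n. n \<ge> N \<Longrightarrow> norm (X m - X n) < e\<close>[OF that]
      by (simp add: apply_ell2_simps)
    then show "\<exists>N. \<forall>n\<ge>N. L2_set (\<lambda>x. cmod (apply_ell2 (X m) x - apply_ell2 (X n) x)) F \<le> e"
      by blast
  qed
  have Cau: "\<exists>N. \<forall>m\<ge>N. \<forall>n\<ge>N. norm (X m - X n) < e" if "e > 0" for e
    using X that by (simp add: Cauchy_def dist_norm)
  obtain N where "\<forall>m\<ge>N. \<forall>n\<ge>N. norm (X m - X n) < 1"
    using Cau[of 1] by auto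
  then have "sq_summable (\<lambda>x. apply_ell2 (X N) x - l x)"
    using close[of N N 1] by (intro sq_summableI[of _ 1]) auto
  then have "sq_summable (\<lambda>x. apply_ell2 (X N) x + (-1) * (apply_ell2 (X N) x - l x))"
    using apply_ell2[of "X N"] by (intro sq_summable_add sq_summable_cmult) auto
  then have "sq_summable l"
    by simp
  then have Abs: "apply_ell2 (Abs_ell2 l) = l"
    by (simp add: Abs_ell2_inverse)
  have "X \<longlonglongrightarrow> Abs_ell2 l"
  proof (rule LIMSEQ_I)
    fix e :: real
    assume "e > 0"
    then obtain N where N: "\<forall>m\<ge>N. \<forall>n\<ge>N. norm (X m - X n) < e / 2"
      using Cau[of "e / 2"] by auto
    have "norm (X m - Abs_ell2 l) < e" if "m \<ge> N" for m
    proof -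
      have "norm (X m - Abs_ell2 l) \<le> e / 2"
        using N that close[of N m "e / 2"] by (intro norm_ell2_leI) (auto simp: apply_ell2_simps Abs)
      then show ?thesis
        using \<open>e > 0\<close> by simp
    qed
    then show "\<exists>N. \<forall>m\<ge>N. norm (X m - Abs_ell2 l) < e"
      by blast
  qed
  then show "convergent X"
    by (auto simp: convergent_def)
qed

text \<open>The pairing is bilinear, without complex conjugation, so that
  \<open>\<lambda>I - P\<close> is symmetric for it even when \<lambda> is not real.\<close>

definition pairing_ell2 :: "'v ell2 \<Rightarrow> 'v ell2 \<Rightarrow> complex" where
  "pairing_ell2 f g = (\<Sum>\<^sub>\<infinity>x. apply_ell2 f x * apply_ell2 g x)"

lemma abs_summable_pairing_ell2:
  "(\<lambda>x. norm (apply_ell2 f x * apply_ell2 g x)) summable_on UNIV"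
  by (rule abs_summable_product)
    (use apply_ell2[of f] apply_ell2[of g] in \<open>auto simp: sq_summable_def norm_mult power2_eq_square\<close>)

lemma norm_pairing_ell2_le: "norm (pairing_ell2 f g) \<le> norm f * norm g"
proof -
  have "norm (pairing_ell2 f g) \<le> (\<Sum>\<^sub>\<infinity>x. norm (apply_ell2 f x * apply_ell2 g x))"
    unfolding pairing_ell2_def by (rule norm_infsum_bound[OF abs_summable_pairing_ell2])
  also have "\<dots> \<le> norm f * norm g"
  proof (rule infsum_le_finite_sums[OF abs_summable_pairing_ell2])
    fix F :: "'a set"
    assume "finite F"
    have "(\<Sum>x\<in>F. norm (apply_ell2 f x * apply_ell2 g x))
        \<le> L2_set (\<lambda>x. cmod (apply_ell2 f x)) F * L2_set (\<lambda>x. cmod (apply_ell2 g x)) F"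
      using L2_set_mult_ineq[of "\<lambda>x. cmod (apply_ell2 f x)" "\<lambda>x. cmod (apply_ell2 g x)" F]
      by (simp add: norm_mult)
    also have "\<dots> \<le> norm f * norm g"
      using \<open>finite F\<close> by (intro mult_mono L2_set_le_norm_ell2) (auto simp: L2_set_nonneg)
    finally show "(\<Sum>x\<in>F. norm (apply_ell2 f x * apply_ell2 g x)) \<le> norm f * norm g" .
  qed
  finally show ?thesis .
qed

lemma bounded_linear_pairing_ell2: "bounded_linear (\<lambda>f. pairing_ell2 f g)"
proof (rule bounded_linear_intro[of _ "norm g"])
  have summable: "(\<lambda>x. apply_ell2 f x * apply_ell2 g x) summable_on UNIV" for f
    by (rule abs_summable_summable[OF abs_summable_pairing_ell2])
  show "pairing_ell2 (f + h) g = pairing_ell2 f g + pairing_ell2 h g" for f h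
    unfolding pairing_ell2_def
    by (simp add: apply_ell2_simps distrib_right infsum_add[OF summable summable])
  show "pairing_ell2 (r *\<^sub>R f) g = r *\<^sub>R pairing_ell2 f g" for r f
    unfolding pairing_ell2_def
    by (simp add: apply_ell2_simps mult.assoc infsum_cmult_right' scaleR_conv_of_real)
qed (rule norm_pairing_ell2_le)

lift_definition unit_ell2 :: "'v \<Rightarrow> 'v ell2" is "\<lambda>y x. if x = y then 1 else 0"
proof -
  fix y :: 'v
  have "(\<lambda>x. (cmod (if x = y then 1 else 0))\<^sup>2) summable_on {y}"
    by simp
  then show "sq_summable (\<lambda>x. if x = y then 1 else 0)"
    unfolding sq_summable_def
    by (rule summable_on_cong_neutral[THEN iffD1, rotated -1]) auto
qed

lemma pairing_unit_ell2: "pairing_ell2 f (unit_ell2 y) = apply_ell2 f y"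
proof -
  have "pairing_ell2 f (unit_ell2 y) = (\<Sum>\<^sub>\<infinity>x\<in>{y}. apply_ell2 f x)"
    unfolding pairing_ell2_def by (rule infsum_cong_neutral) (auto simp: unit_ell2.rep_eq)
  then show ?thesis
    by simp
qed

text \<open>Coordinates of the inverse are continuous because
  \<open>(A\<^sup>-\<^sup>1 g)(z) = \<langle>g, A\<^sup>-\<^sup>1 1\<^sub>z\<rangle>\<close>; hence the sets \<open>{g. \<parallel>A\<^sup>-\<^sup>1 g\<parallel> \<le> n}\<close> are closed, and Baire's
  theorem gives a ball inside one of them.\<close>

lemma bounded_linear_inv_symmetric_ell2:
  fixes A :: "'v ell2 \<Rightarrow> 'v ell2"
  assumes lin: "linear A" and bij: "bij A"
    and sym: "\<And>f g. pairing_ell2 (A f) g = pairing_ell2 f (A g)"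
  shows "bounded_linear (inv A)"
proof -
  have AR: "A (inv A g) = g" for g
    using bij by (simp add: bij_is_surj surj_f_inv_f)
  have RA: "inv A (A g) = g" for g
    using bij by (simp add: bij_is_inj)
  have linR: "linear (inv A)"
  proof (rule linearI)
    show "inv A (f + g) = inv A f + inv A g" for f g
      using RA[of "inv A f + inv A g"] by (simp add: linear_add[OF lin] AR)
    show "inv A (r *\<^sub>R f) = r *\<^sub>R inv A f" for r f
      using RA[of "r *\<^sub>R inv A f"] by (simp add: linear_scale[OF lin] AR)
  qed
  have coord: "apply_ell2 (inv A g) z = pairing_ell2 g (inv A (unit_ell2 z))" for g z
    using sym[of "inv A g" "inv A (unit_ell2 z)"] by (simp add: AR pairing_unit_ell2)
  define E where "E n = {g. norm (inv A g) \<le> real n}" for n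
  have E_eq: "E n = (\<Inter>F\<in>{F. finite F}. {g. L2_set (\<lambda>z. cmod (pairing_ell2 g (inv A (unit_ell2 z)))) F \<le> real n})" for n
    unfolding E_def coord[symmetric] by (auto simp: norm_ell2_le_iff)
  have closed: "closed (E n)" for n
    unfolding E_eq L2_set_def
    by (intro closed_INT ballI closed_Collect_le continuous_intros
        bounded_linear.continuous_on[OF bounded_linear_pairing_ell2])
  have cover: "(\<Union>n. E n) = UNIV"
    unfolding E_def using real_arch_simple by auto
  have "\<exists>n. interior (E n) \<noteq> {}"
  proof (rule ccontr)
    assume "\<not> ?thesis"
    then have "Met_TC.mtopology interior_of \<Union>(range E) = {}"
      by (intro Met_TC.metric_Baire_category_alt) (auto simp: closed complete_UNIV)
    then show False
      by (simp add: cover)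
  qed
  then obtain n g0 where "g0 \<in> interior (E n)"
    by blast
  then obtain e where e: "e > 0" "ball g0 e \<subseteq> E n"
    by (auto simp: mem_interior)
  \<comment> \<open>A vector of norm below \<open>e\<close> is the difference of two points of the
    ball around \<open>g0\<close>, and the image of each has norm at most \<open>n\<close>.\<close>
  have bound: "norm (inv A g) \<le> 2 * real n" if "norm g < e" for g
  proof -
    have "g0 + g \<in> E n" "g0 \<in> E n"
      using e that by (auto simp: dist_norm subset_iff)
    then have "norm (inv A (g0 + g) - inv A g0) \<le> real n + real n"
      unfolding E_def by (intro order_trans[OF norm_triangle_ineq4] add_mono) auto
    then show ?thesis
      by (simp add: linear_add[OF linR])
  qed
  have "norm (inv A g) \<le> norm g * (2 * real n / (e / 2))" for g
  proof (cases "g = 0")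
    case False
    \<comment> \<open>Rescaling to norm \<open>e / 2\<close> puts the vector strictly inside the
      range of \<open>bound\<close>.\<close>
    define c where "c = e / 2 / norm g"
    have "c > 0"
      using False e by (simp add: c_def)
    have "norm (inv A (c *\<^sub>R g)) \<le> 2 * real n"
      using False e by (intro bound) (simp add: c_def)
    then have "c * norm (inv A g) \<le> 2 * real n"
      using \<open>c > 0\<close> by (simp add: linear_scale[OF linR])
    then show ?thesis
      using False e by (simp add: c_def field_simps)
  qed (simp add: linear_0[OF linR])
  then show ?thesis
    by (intro bounded_linear_intro[of _ "2 * real n / (e / 2)"] linear_add[OF linR] linear_scale[OF linR])
qed

section \<open>Resolvents of reversible kernels\<close>

lemma has_sum_sum:
  fixes f :: "'i \<Rightarrow> 'a \<Rightarrow> 'b::topological_comm_monoid_add"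
  assumes "\<And>i. i \<in> I \<Longrightarrow> (f i has_sum s i) A"
  shows "((\<lambda>x. \<Sum>i\<in>I. f i x) has_sum (\<Sum>i\<in>I. s i)) A"
  using assms by (induction I rule: infinite_finite_induct) (auto intro: has_sum_add)

lemma bounded_linear_onorm_funpow:
  fixes R :: "'a::real_normed_vector \<Rightarrow> 'a"
  assumes "bounded_linear R"
  shows "norm ((R ^^ k) g) \<le> onorm R ^ k * norm g"
proof (induction k)
  case (Suc k)
  have "norm (R ((R ^^ k) g)) \<le> onorm R * norm ((R ^^ k) g)"
    by (rule onorm[OF assms])
  also have "\<dots> \<le> onorm R * (onorm R ^ k * norm g)"
    using Suc.IH onorm_pos_le[OF assms] by (rule mult_left_mono)
  finally show ?case
    by (simp add: mult.assoc)
qed simp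

text \<open>The expansion \<open>(\<mu>I - T)^-1 = \<Sum>k. (lam - \<mu>)^k R^(k+1)\<close>, where
  \<open>R\<close> is a right inverse of \<open>lam I - T\<close>. A geometric series dominates it,
  and applying \<open>\<mu>I - T\<close> makes it telescope.\<close>

lemma neumann_series_ell2:
  fixes T R :: "'v ell2 \<Rightarrow> 'v ell2"
  assumes T: "bounded_linear T" and R: "bounded_linear R"
    and right: "\<And>g. scaleC_ell2 lam (R g) - T (R g) = g"
    and T_scaleC: "\<And>c f. T (scaleC_ell2 c f) = scaleC_ell2 c (T f)"
    and small: "cmod (lam - \<mu>) * onorm R < 1"
  defines "t \<equiv> \<lambda>g k. scaleC_ell2 ((lam - \<mu>) ^ k) ((R ^^ Suc k) g)"
  shows "summable (t g)" and "scaleC_ell2 \<mu> (suminf (t g)) - T (suminf (t g)) = g"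
proof -
  define q where "q = cmod (lam - \<mu>) * onorm R"
  have q: "0 \<le> q" "q < 1"
    using small onorm_pos_le[OF R] by (auto simp: q_def)
  \<comment> \<open>Chosen so that \<open>\<mu>I - T\<close> sends the \<open>k\<close>-th term to
    \<open>u k - u (Suc k)\<close>. As \<open>u\<close> tends to 0, the telescoping sum is
    \<open>u 0 = g\<close>.\<close>
  define u where "u k = scaleC_ell2 ((lam - \<mu>) ^ k) ((R ^^ k) g)" for k
  have u: "norm (u k) \<le> q ^ k * norm g" for k
    using mult_left_mono[OF bounded_linear_onorm_funpow[OF R, of k g], of "cmod (lam - \<mu>) ^ k"]
    by (simp add: u_def norm_scaleC_ell2 norm_power q_def power_mult_distrib mult.assoc)
  have t: "norm (t g k) \<le> q ^ k * (onorm R * norm g)" for k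
    using mult_left_mono[OF bounded_linear_onorm_funpow[OF R, of "Suc k" g], of "cmod (lam - \<mu>) ^ k"]
    by (simp add: t_def norm_scaleC_ell2 norm_power q_def power_mult_distrib mult.assoc mult.left_commute)
  show summable: "summable (t g)"
    by (rule summable_comparison_test'[OF summable_mult2[OF summable_geometric]]) (use q t in auto)
  have "(\<lambda>k. q ^ k * norm g) \<longlonglongrightarrow> 0 * norm g"
    using q by (intro tendsto_intros LIMSEQ_power_zero) auto
  then have "u \<longlonglongrightarrow> 0"
    by (intro Lim_null_comparison[of u "\<lambda>k. q ^ k * norm g"]) (use u in auto)
  then have telescope: "(\<lambda>k. u k - u (Suc k)) sums g"
    using telescope_sums'[of u 0] by (simp add: u_def scaleC_ell2_simps)
  define A where "A f = scaleC_ell2 \<mu> f - T f" for f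
  have A: "bounded_linear A"
    unfolding A_def by (intro bounded_linear_sub bounded_linear_scaleC_ell2 T)
  have "A (t g k) = u k - u (Suc k)" for k
  proof -
    let ?h = "(R ^^ k) g"
    have "A (t g k) = scaleC_ell2 ((lam - \<mu>) ^ k) (A (R ?h))"
      by (simp add: A_def t_def T_scaleC scaleC_ell2_simps mult.commute)
    also have "A (R ?h) = (scaleC_ell2 lam (R ?h) - T (R ?h)) - scaleC_ell2 (lam - \<mu>) (R ?h)"
      by (simp add: A_def scaleC_ell2_simps)
    also have "\<dots> = ?h - scaleC_ell2 (lam - \<mu>) (R ?h)"
      by (simp only: right)
    finally show ?thesis
      by (simp add: u_def scaleC_ell2_simps(1-3) mult.commute)
  qed
  then have "(\<lambda>k. u k - u (Suc k)) sums A (suminf (t g))"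
    using bounded_linear.sums[OF A summable_sums[OF summable]] by simp
  then show "scaleC_ell2 \<mu> (suminf (t g)) - T (suminf (t g)) = g"
    using telescope sums_unique2 unfolding A_def by blast
qed

text \<open>From \<open>T f = \<mu> f\<close> it follows that
  \<open>f = R ((lam - \<mu>) f)\<close>, and the operator on the right has norm below 1.\<close>

lemma resolvent_injective_ell2:
  fixes T R :: "'v ell2 \<Rightarrow> 'v ell2"
  assumes R: "bounded_linear R"
    and left: "\<And>f. R (scaleC_ell2 lam f - T f) = f"
    and small: "cmod (lam - \<mu>) * onorm R < 1"
    and zero: "scaleC_ell2 \<mu> f - T f = 0"
  shows "f = 0"
proof (rule ccontr)
  assume "f \<noteq> 0"
  have "T f = scaleC_ell2 \<mu> f"
    using zero by simp
  then have "scaleC_ell2 lam f - T f = scaleC_ell2 (lam - \<mu>) f"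
    by (simp add: scaleC_ell2_simps)
  then have "norm f \<le> onorm R * norm (scaleC_ell2 (lam - \<mu>) f)"
    using left[of f] onorm[OF R] by metis
  also have "\<dots> = (cmod (lam - \<mu>) * onorm R) * norm f"
    by (simp add: norm_scaleC_ell2)
  also have "\<dots> < 1 * norm f"
    using \<open>f \<noteq> 0\<close> small by (intro mult_strict_right_mono) auto
  finally show False
    by simp
qed

section \<open>The transition operator on the weighted space of a reversible kernel\<close>

lemma Pdefined_summable: "Pdefined p u \<Longrightarrow> (\<lambda>y. complex_of_real (p x y) * u y) summable_on UNIV"
  unfolding Pdefined_def by (blast intro: abs_summable_summable)

lemma Pop_add:
  "Pdefined p u \<Longrightarrow> Pdefined p v \<Longrightarrow> Pop p (\<lambda>x. u x + v x) x = Pop p u x + Pop p v x"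
  unfolding Pop_def by (simp add: distrib_left infsum_add Pdefined_summable)

lemma Pop_cmult: "Pop p (\<lambda>x. c * u x) x = c * Pop p u x"
  unfolding Pop_def by (simp add: infsum_cmult_right' mult.left_commute)

text \<open>Detailed balance with respect to \<open>m\<close> is what makes the transition operator
  self-adjoint. The Hilbert space theory is carried out for any such kernel and later applied with
  \<open>m = mfun adj p rt\<close>.\<close>

locale reversible_kernel =
  fixes p :: "'v \<Rightarrow> 'v \<Rightarrow> real" and m :: "'v \<Rightarrow> real"
  assumes p_nonneg: "0 \<le> p x y"
    and p_sum: "(p x has_sum 1) UNIV"
    and m_pos: "0 < m x"
    and balance: "m x * p x y = m y * p y x"
begin

definition wl2 :: "('v \<Rightarrow> complex) set" where
  "wl2 = {u. (\<lambda>x. (cmod (u x))\<^sup>2 * m x) summable_on UNIV}"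

text \<open>Multiplication by the square root of the weight is an isometry from \<open>wl2\<close>
  onto the unweighted space; outside \<open>wl2\<close> the value is unspecified.\<close>

definition to_ell2 :: "('v \<Rightarrow> complex) \<Rightarrow> 'v ell2" where
  "to_ell2 u = Abs_ell2 (\<lambda>x. of_real (sqrt (m x)) * u x)"

definition of_ell2 :: "'v ell2 \<Rightarrow> 'v \<Rightarrow> complex" where
  "of_ell2 f x = apply_ell2 f x / of_real (sqrt (m x))"

lemma sqrt_m_pos [simp]: "sqrt (m x) > 0" "sqrt (m x) \<noteq> 0" "m x \<noteq> 0" "m x \<ge> 0"
  using m_pos[of x] by auto

lemma norm_sqrt_m: "(cmod (of_real (sqrt (m x)) * c))\<^sup>2 = (cmod c)\<^sup>2 * m x"
  by (simp add: norm_mult power_mult_distrib mult.commute)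

lemma wl2_iff: "u \<in> wl2 \<longleftrightarrow> sq_summable (\<lambda>x. of_real (sqrt (m x)) * u x)"
  unfolding wl2_def sq_summable_def norm_sqrt_m by simp

lemma apply_to_ell2: "u \<in> wl2 \<Longrightarrow> apply_ell2 (to_ell2 u) x = of_real (sqrt (m x)) * u x"
  by (simp add: to_ell2_def Abs_ell2_inverse wl2_iff)

lemma norm_to_ell2: "u \<in> wl2 \<Longrightarrow> norm (to_ell2 u) = sqrt (\<Sum>\<^sub>\<infinity>x. (cmod (u x))\<^sup>2 * m x)"
  by (simp add: norm_ell2.rep_eq to_ell2_def Abs_ell2_inverse wl2_iff l2norm_def norm_sqrt_m)

lemma of_ell2_in_wl2: "of_ell2 f \<in> wl2"
  using apply_ell2[of f] by (simp add: wl2_iff of_ell2_def)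

lemma of_to_ell2: "u \<in> wl2 \<Longrightarrow> of_ell2 (to_ell2 u) = u"
  by (auto simp: of_ell2_def apply_to_ell2)

lemma to_of_ell2: "to_ell2 (of_ell2 f) = f"
  by (rule ell2_eqI) (simp add: apply_to_ell2[OF of_ell2_in_wl2] of_ell2_def)

lemma wl2_add: "u \<in> wl2 \<Longrightarrow> v \<in> wl2 \<Longrightarrow> (\<lambda>x. u x + v x) \<in> wl2"
  using sq_summable_add unfolding wl2_iff by (fastforce simp: distrib_left)

lemma wl2_cmult: "u \<in> wl2 \<Longrightarrow> (\<lambda>x. c * u x) \<in> wl2"
  using sq_summable_cmult[of _ c] unfolding wl2_iff by (fastforce simp: mult.left_commute)

lemma wl2_zero: "(\<lambda>x. 0) \<in> wl2"
  by (simp add: wl2_def)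

lemma wl2_diff: "u \<in> wl2 \<Longrightarrow> v \<in> wl2 \<Longrightarrow> (\<lambda>x. u x - v x) \<in> wl2"
  using wl2_add[of u "\<lambda>x. -1 * v x"] wl2_cmult[of v "-1"] by simp

lemma wl2_sum: "(\<And>i. i \<in> I \<Longrightarrow> u i \<in> wl2) \<Longrightarrow> (\<lambda>x. \<Sum>i\<in>I. u i x) \<in> wl2"
  by (induction I rule: infinite_finite_induct) (auto intro: wl2_add wl2_zero)

lemma wl2_dominated:
  assumes "u \<in> wl2" "\<And>x. cmod (v x) \<le> cmod (u x)"
  shows "v \<in> wl2"
  using assms unfolding wl2_def
  by (auto intro!: summable_on_comparison_test[of "\<lambda>x. (cmod (u x))\<^sup>2 * m x"] mult_right_mono power_mono)

lemma wl2_restrict: "u \<in> wl2 \<Longrightarrow> (\<lambda>x. if x \<in> S then u x else 0) \<in> wl2"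
  by (erule wl2_dominated) auto

lemma wl2_indicator: "(\<lambda>x. if x = y then 1 else 0) \<in> wl2"
  unfolding wl2_def
  by (auto intro!: finite_nonzero_values_imp_summable_on finite_subset[of _ "{y}"] split: if_splits)

lemma p_le_1: "p x y \<le> 1"
  using finite_sum_le_has_sum[OF p_sum, of "{y}" x] p_nonneg by simp

lemma p_eq_balance: "p x y = m y * p y x / m x"
  using balance[of x y] by (simp add: field_simps)

text \<open>Detailed balance and \<open>p y x \<le> 1\<close> give
  \<open>p x y \<le> m y / m x\<close>, so the series is dominated by a multiple of the weighted
  square norm.\<close>

lemma summable_p_square:
  assumes "u \<in> wl2"
  shows "(\<lambda>y. p x y * (cmod (u y))\<^sup>2) summable_on UNIV"
proof (rule summable_on_comparison_test)
  show "(\<lambda>y. (cmod (u y))\<^sup>2 * m y * (1 / m x)) summable_on UNIV"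
    using assms unfolding wl2_def by (intro summable_on_cmult_left) auto
  show "p x y * (cmod (u y))\<^sup>2 \<le> (cmod (u y))\<^sup>2 * m y * (1 / m x)" for y
  proof -
    have "p x y \<le> m y / m x"
      using p_le_1[of y x] mult_left_mono[of "p y x" 1 "m y"] m_pos[of x]
      by (simp add: p_eq_balance[of x y] divide_right_mono)
    then show ?thesis
      using mult_left_mono[of "p x y" "m y / m x" "(cmod (u y))\<^sup>2"] by (simp add: mult.commute)
  qed
qed (simp add: p_nonneg)

text \<open>Cauchy-Schwarz after splitting \<open>p x y\<close> into two factors
  \<open>sqrt (p x y)\<close>: the first factor has norm 1 because the rows of \<open>p\<close> sum
  to 1.\<close>

lemma
  assumes "u \<in> wl2"
  shows Pdefined_wl2: "Pdefined p u"
    and norm_Pop_square_le: "(cmod (Pop p u x))\<^sup>2 \<le> (\<Sum>\<^sub>\<infinity>y. p x y * (cmod (u y))\<^sup>2)"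
proof -
  define a where "a x = Abs_ell2 (\<lambda>y. complex_of_real (sqrt (p x y)))" for x
  define b where "b x = Abs_ell2 (\<lambda>y. complex_of_real (sqrt (p x y)) * u y)" for x
  have sa: "sq_summable (\<lambda>y. complex_of_real (sqrt (p x y)))" for x
    using has_sum_imp_summable[OF p_sum] by (simp add: sq_summable_def p_nonneg)
  have sb: "sq_summable (\<lambda>y. complex_of_real (sqrt (p x y)) * u y)" for x
    using summable_p_square[OF assms]
    by (simp add: sq_summable_def p_nonneg norm_mult power_mult_distrib)
  have a: "apply_ell2 (a x) y = complex_of_real (sqrt (p x y))" for x y
    using sa by (simp add: a_def Abs_ell2_inverse)
  have b: "apply_ell2 (b x) y = complex_of_real (sqrt (p x y)) * u y" for x y
    using sb by (simp add: b_def Abs_ell2_inverse)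
  have ab: "apply_ell2 (a x) y * apply_ell2 (b x) y = complex_of_real (p x y) * u y" for x y
    using p_nonneg[of x y] by (simp add: a b mult.assoc[symmetric] flip: of_real_mult)
  show "Pdefined p u"
    unfolding Pdefined_def using abs_summable_pairing_ell2[of "a x" "b x" for x] by (simp add: ab)
  have "norm (a x) = 1"
    using infsumI[OF p_sum] by (simp add: norm_ell2.rep_eq l2norm_def a p_nonneg)
  moreover have "norm (b x) = sqrt (\<Sum>\<^sub>\<infinity>y. p x y * (cmod (u y))\<^sup>2)"
    by (simp add: norm_ell2.rep_eq l2norm_def b p_nonneg norm_mult power_mult_distrib)
  ultimately have "cmod (Pop p u x) \<le> sqrt (\<Sum>\<^sub>\<infinity>y. p x y * (cmod (u y))\<^sup>2)"
    using norm_pairing_ell2_le[of "a x" "b x"] by (simp add: pairing_ell2_def Pop_def ab)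
  then show "(cmod (Pop p u x))\<^sup>2 \<le> (\<Sum>\<^sub>\<infinity>y. p x y * (cmod (u y))\<^sup>2)"
    using power_mono[of "cmod (Pop p u x)" "sqrt (\<Sum>\<^sub>\<infinity>y. p x y * (cmod (u y))\<^sup>2)" 2]
    by (simp add: infsum_nonneg p_nonneg)
qed

text \<open>The rowwise Cauchy-Schwarz bound is summed over \<open>x\<close> in a finite set and the
  order of summation exchanged. Detailed balance turns the column sum of \<open>m x * p x y\<close>
  into \<open>m y\<close> times a partial row sum, which is at most \<open>m y\<close>.\<close>

lemma
  assumes "u \<in> wl2"
  shows Pop_in_wl2: "Pop p u \<in> wl2"
    and norm_Pop_le: "(\<Sum>\<^sub>\<infinity>x. (cmod (Pop p u x))\<^sup>2 * m x) \<le> (\<Sum>\<^sub>\<infinity>x. (cmod (u x))\<^sup>2 * m x)"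
proof -
  have su: "(\<lambda>x. (cmod (u x))\<^sup>2 * m x) summable_on UNIV"
    using assms by (simp add: wl2_def)
  have *: "(\<Sum>x\<in>F. (cmod (Pop p u x))\<^sup>2 * m x) \<le> (\<Sum>\<^sub>\<infinity>x. (cmod (u x))\<^sup>2 * m x)" if "finite F" for F
  proof -
    have columns: "((\<lambda>y. \<Sum>x\<in>F. p x y * (cmod (u y))\<^sup>2 * m x)
        has_sum (\<Sum>x\<in>F. \<Sum>\<^sub>\<infinity>y. p x y * (cmod (u y))\<^sup>2 * m x)) UNIV"
      using summable_p_square[OF assms] by (intro has_sum_sum has_sum_infsum summable_on_cmult_left)
    have "(\<Sum>x\<in>F. (cmod (Pop p u x))\<^sup>2 * m x) \<le> (\<Sum>x\<in>F. (\<Sum>\<^sub>\<infinity>y. p x y * (cmod (u y))\<^sup>2) * m x)"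
      using norm_Pop_square_le[OF assms] by (intro sum_mono mult_right_mono) auto
    also have "\<dots> = (\<Sum>x\<in>F. \<Sum>\<^sub>\<infinity>y. p x y * (cmod (u y))\<^sup>2 * m x)"
      by (simp add: infsum_cmult_left')
    also have "\<dots> = (\<Sum>\<^sub>\<infinity>y. \<Sum>x\<in>F. p x y * (cmod (u y))\<^sup>2 * m x)"
      by (rule infsumI[OF columns, symmetric])
    also have "\<dots> \<le> (\<Sum>\<^sub>\<infinity>y. (cmod (u y))\<^sup>2 * m y)"
    proof (rule infsum_mono)
      show "(\<lambda>y. \<Sum>x\<in>F. p x y * (cmod (u y))\<^sup>2 * m x) summable_on UNIV"
        by (rule has_sum_imp_summable[OF columns])
      fix y
      have "(\<Sum>x\<in>F. p x y * (cmod (u y))\<^sup>2 * m x) = (\<Sum>x\<in>F. (cmod (u y))\<^sup>2 * m y * p y x)"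
        using balance[of _ y] by (intro sum.cong) (auto simp: mult_ac)
      also have "\<dots> = (cmod (u y))\<^sup>2 * m y * (\<Sum>x\<in>F. p y x)"
        by (simp add: sum_distrib_left)
      also have "\<dots> \<le> (cmod (u y))\<^sup>2 * m y * 1"
        using finite_sum_le_has_sum[OF p_sum that, of y] p_nonneg by (intro mult_left_mono) auto
      finally show "(\<Sum>x\<in>F. p x y * (cmod (u y))\<^sup>2 * m x) \<le> (cmod (u y))\<^sup>2 * m y"
        by simp
    qed (rule su)
    finally show ?thesis .
  qed
  have "(\<lambda>x. (cmod (Pop p u x))\<^sup>2 * m x) summable_on UNIV"
    using * by (intro nonneg_bdd_above_summable_on) (auto intro!: bdd_aboveI)
  then show "Pop p u \<in> wl2"
    "(\<Sum>\<^sub>\<infinity>x. (cmod (Pop p u x))\<^sup>2 * m x) \<le> (\<Sum>\<^sub>\<infinity>x. (cmod (u x))\<^sup>2 * m x)"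
    using * by (auto simp: wl2_def intro: infsum_le_finite_sums)
qed

section \<open>Symmetry of the transported operator and expansion of its resolvent\<close>

definition P_ell2 :: "'v ell2 \<Rightarrow> 'v ell2" where
  "P_ell2 f = to_ell2 (Pop p (of_ell2 f))"

lemma apply_P_ell2: "apply_ell2 (P_ell2 f) x = of_real (sqrt (m x)) * Pop p (of_ell2 f) x"
  by (simp add: P_ell2_def apply_to_ell2 Pop_in_wl2 of_ell2_in_wl2)

lemma bounded_linear_P_ell2: "bounded_linear P_ell2"
proof (rule bounded_linear_intro[of _ 1])
  fix f g and r :: real
  have "of_ell2 (f + g) = (\<lambda>x. of_ell2 f x + of_ell2 g x)"
    by (auto simp: of_ell2_def apply_ell2_simps add_divide_distrib)
  then show "P_ell2 (f + g) = P_ell2 f + P_ell2 g"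
    by (intro ell2_eqI)
      (simp add: apply_P_ell2 apply_ell2_simps Pop_add Pdefined_wl2 of_ell2_in_wl2 distrib_left)
  have "of_ell2 (r *\<^sub>R f) = (\<lambda>x. of_real r * of_ell2 f x)"
    by (auto simp: of_ell2_def apply_ell2_simps)
  then show "P_ell2 (r *\<^sub>R f) = r *\<^sub>R P_ell2 f"
    by (intro ell2_eqI) (simp add: apply_P_ell2 apply_ell2_simps Pop_cmult)
  have "norm (P_ell2 f) \<le> norm (to_ell2 (of_ell2 f))"
    unfolding P_ell2_def
    by (simp add: norm_to_ell2 of_ell2_in_wl2 Pop_in_wl2 norm_Pop_le)
  then show "norm (P_ell2 f) \<le> norm f * 1"
    by (simp add: to_of_ell2)
qed

lemma P_ell2_scaleC: "P_ell2 (scaleC_ell2 c f) = scaleC_ell2 c (P_ell2 f)"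
proof -
  have "of_ell2 (scaleC_ell2 c f) = (\<lambda>x. c * of_ell2 f x)"
    by (auto simp: of_ell2_def apply_ell2_simps)
  then show ?thesis
    by (intro ell2_eqI) (simp add: apply_P_ell2 apply_ell2_simps Pop_cmult)
qed

text \<open>Both sides are iterated sums of the same double family \<open>k\<close>, by detailed
  balance. It remains to justify exchanging the two summations.\<close>

lemma pairing_P_ell2: "pairing_ell2 (P_ell2 f) g = pairing_ell2 f (P_ell2 g)"
proof -
  define u v where "u = of_ell2 f" and "v = of_ell2 g"
  have uv: "u \<in> wl2" "v \<in> wl2"
    by (auto simp: u_def v_def of_ell2_in_wl2)
  have fg: "apply_ell2 f x = of_real (sqrt (m x)) * u x" "apply_ell2 g x = of_real (sqrt (m x)) * v x" for x
    by (auto simp: u_def v_def of_ell2_def)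
  have m: "of_real (sqrt (m x)) * a * (of_real (sqrt (m x)) * b) = of_real (m x) * a * b" for x and a b :: complex
    by (simp add: mult_ac flip: mult.assoc of_real_mult)
  define k where "k x y = complex_of_real (m x * p x y) * u y * v x" for x y
  \<comment> \<open>The moduli of \<open>u\<close> and \<open>v\<close> again lie in
    \<open>wl2\<close>. The convergent pairing of \<open>P\<close> applied to \<open>au\<close> with
    \<open>av\<close> is exactly the absolute double series of \<open>k\<close>.\<close>
  define au where "au x = complex_of_real (cmod (u x))" for x
  define av where "av x = complex_of_real (cmod (v x))" for x
  have auv: "au \<in> wl2" "av \<in> wl2"
    using wl2_dominated[OF uv(1), of au] wl2_dominated[OF uv(2), of av] by (auto simp: au_def av_def)
  have normk: "complex_of_real (norm (k x y)) = of_real (m x) * av x * (of_real (p x y) * au y)" for x y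
    by (simp add: k_def norm_mult p_nonneg au_def av_def)
  have row: "(\<lambda>y. norm (k x y)) summable_on UNIV" for x
  proof -
    have "(\<lambda>y. norm (k x y)) = (\<lambda>y. m x * cmod (v x) * norm (of_real (p x y) * u y))"
      by (auto simp: k_def norm_mult p_nonneg)
    then show ?thesis
      using Pdefined_wl2[OF uv(1)] unfolding Pdefined_def by (simp add: summable_on_cmult_right)
  qed
  have "(\<lambda>x. norm (apply_ell2 (P_ell2 (to_ell2 au)) x * apply_ell2 (to_ell2 av) x)) summable_on UNIV"
    by (rule abs_summable_pairing_ell2)
  also have "(\<lambda>x. norm (apply_ell2 (P_ell2 (to_ell2 au)) x * apply_ell2 (to_ell2 av) x))
      = (\<lambda>x. norm (\<Sum>\<^sub>\<infinity>y. norm (k x y)))"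
  proof
    fix x
    have "complex_of_real (\<Sum>\<^sub>\<infinity>y. norm (k x y)) = (\<Sum>\<^sub>\<infinity>y. complex_of_real (norm (k x y)))"
      using has_sum_of_real[OF has_sum_infsum[OF row[of x]]] by (rule infsumI[symmetric])
    also have "\<dots> = of_real (m x) * av x * Pop p au x"
      unfolding normk Pop_def by (rule infsum_cmult_right')
    also have "\<dots> = apply_ell2 (P_ell2 (to_ell2 au)) x * apply_ell2 (to_ell2 av) x"
      unfolding apply_P_ell2 of_to_ell2[OF auv(1)] apply_to_ell2[OF auv(2)] m by (simp only: mult_ac)
    finally show "norm (apply_ell2 (P_ell2 (to_ell2 au)) x * apply_ell2 (to_ell2 av) x) = norm (\<Sum>\<^sub>\<infinity>y. norm (k x y))"
      by (metis norm_of_real real_norm_def)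
  qed
  finally have "(\<lambda>z. norm (case z of (x, y) \<Rightarrow> k x y)) summable_on UNIV \<times> UNIV"
    using row by (subst Infinite_Sum.abs_summable_on_Sigma_iff) (auto simp: case_prod_unfold)
  then have swap: "(\<Sum>\<^sub>\<infinity>x. \<Sum>\<^sub>\<infinity>y. k x y) = (\<Sum>\<^sub>\<infinity>y. \<Sum>\<^sub>\<infinity>x. k x y)"
    by (rule infsum_swap_banach[OF abs_summable_summable])
  have "pairing_ell2 (P_ell2 f) g = (\<Sum>\<^sub>\<infinity>x. \<Sum>\<^sub>\<infinity>y. k x y)"
  proof -
    have k: "k x y = of_real (m x) * (of_real (p x y) * u y) * v x" for x y
      by (simp add: k_def)
    show ?thesis
      unfolding pairing_ell2_def apply_P_ell2 fg(2) m k Pop_def u_def[symmetric]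
      by (simp only: infsum_cmult_right' infsum_cmult_left')
  qed
  moreover have "pairing_ell2 f (P_ell2 g) = (\<Sum>\<^sub>\<infinity>y. \<Sum>\<^sub>\<infinity>x. k x y)"
  proof -
    have k: "k x y = of_real (m y) * u y * (of_real (p y x) * v x)" for x y
      using balance[of x y] by (simp add: k_def)
    show ?thesis
      unfolding pairing_ell2_def apply_P_ell2 fg(1) m k Pop_def v_def[symmetric]
      by (simp only: infsum_cmult_right')
  qed
  ultimately show ?thesis
    by (simp add: swap)
qed

lemma Lop_eq_ell2_iff:
  assumes "u \<in> wl2" "g \<in> wl2"
  shows "Lop p \<mu> u = g \<longleftrightarrow> scaleC_ell2 \<mu> (to_ell2 u) - P_ell2 (to_ell2 u) = to_ell2 g"
proof -
  have "apply_ell2 (scaleC_ell2 \<mu> (to_ell2 u) - P_ell2 (to_ell2 u)) x = of_real (sqrt (m x)) * Lop p \<mu> u x" for x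
    by (simp add: apply_ell2_simps apply_P_ell2 apply_to_ell2 assms of_to_ell2 Lop_def algebra_simps)
  then have "scaleC_ell2 \<mu> (to_ell2 u) - P_ell2 (to_ell2 u) = to_ell2 g
      \<longleftrightarrow> (\<forall>x. of_real (sqrt (m x)) * Lop p \<mu> u x = of_real (sqrt (m x)) * g x)"
    using apply_to_ell2[OF assms(2)] by (metis ell2_eqI)
  then show ?thesis
    by (auto simp: fun_eq_iff)
qed

text \<open>Here \<open>w k\<close> is \<open>(lam I - P)^-1\<close> applied \<open>k + 1\<close>
  times to \<open>g\<close>, described by a recursion. The last clause gives every solution at \<mu>
  the same expansion, so it contains uniqueness.\<close>

definition resolvent_coeffs :: "complex \<Rightarrow> real \<Rightarrow> ('v \<Rightarrow> complex) \<Rightarrow> (nat \<Rightarrow> 'v \<Rightarrow> complex) \<Rightarrow> bool" where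
  "resolvent_coeffs lam \<delta> g w \<longleftrightarrow>
    (\<forall>k. w k \<in> wl2) \<and> Lop p lam (w 0) = g \<and> (\<forall>k. Lop p lam (w (Suc k)) = w k) \<and>
    (\<forall>\<mu>\<in>ball lam \<delta>. \<exists>f\<in>wl2. Lop p \<mu> f = g) \<and>
    (\<forall>\<mu>\<in>ball lam \<delta>. \<forall>f\<in>wl2. Lop p \<mu> f = g \<longrightarrow> (\<forall>x. (\<lambda>k. (lam - \<mu>) ^ k * w k x) sums f x))"

text \<open>The assumption is bijectivity of \<open>lam I - P\<close> as a map on
  \<open>wl2\<close>. Symmetry makes the inverse bounded, and then the Neumann series applies, with
  one radius for all right-hand sides.\<close>

lemma resolvent_expansion:
  assumes res: "\<And>g. g \<in> wl2 \<Longrightarrow> \<exists>!f. f \<in> wl2 \<and> Lop p lam f = g"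
  shows "\<exists>\<delta>>0. \<forall>g\<in>wl2. \<exists>w. resolvent_coeffs lam \<delta> g w"
proof -
  define A where "A \<mu> f = scaleC_ell2 \<mu> f - P_ell2 f" for \<mu> f
  have A: "bounded_linear (A \<mu>)" for \<mu>
    unfolding A_def by (intro bounded_linear_sub bounded_linear_scaleC_ell2 bounded_linear_P_ell2)
  have ex1: "\<exists>!f. A lam f = g" for g
  proof -
    obtain u where u: "u \<in> wl2" "Lop p lam u = of_ell2 g"
      using res[OF of_ell2_in_wl2] by blast
    have "A lam (to_ell2 u) = g"
      using u by (simp add: A_def Lop_eq_ell2_iff of_ell2_in_wl2 to_of_ell2)
    moreover have "f = to_ell2 u" if "A lam f = g" for f
    proof -
      have "Lop p lam (of_ell2 f) = of_ell2 g"
        using that by (simp add: A_def Lop_eq_ell2_iff of_ell2_in_wl2 to_of_ell2)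
      then show ?thesis
        using res[OF of_ell2_in_wl2] u of_ell2_in_wl2 to_of_ell2 by metis
    qed
    ultimately show ?thesis
      by blast
  qed
  then have bij: "bij (A lam)"
    by (metis bijI' )
  define R where "R = inv (A lam)"
  have AR: "A lam (R g) = g" and RA: "R (A lam g) = g" for g
    using bij by (simp_all add: R_def bij_is_surj surj_f_inv_f bij_is_inj)
  have sym: "pairing_ell2 (A lam f) g = pairing_ell2 f (A lam g)" for f g
  proof -
    have comm: "pairing_ell2 h k = pairing_ell2 k h" for h k :: "'v ell2"
      by (simp add: pairing_ell2_def mult.commute)
    have scale: "pairing_ell2 (scaleC_ell2 c h) k = c * pairing_ell2 h k" for c and h k :: "'v ell2"
      by (simp add: pairing_ell2_def apply_ell2_simps infsum_cmult_right' mult.assoc)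
    have "pairing_ell2 (A lam f) g = lam * pairing_ell2 f g - pairing_ell2 (P_ell2 f) g" for f g
      unfolding A_def
      by (simp add: linear_diff[OF bounded_linear.linear[OF bounded_linear_pairing_ell2]] scale)
    then show ?thesis
      using pairing_P_ell2 comm by metis
  qed
  have R: "bounded_linear R"
    unfolding R_def using bounded_linear_inv_symmetric_ell2[OF _ bij sym] A
    by (simp add: bounded_linear.linear)
  \<comment> \<open>The summand 1 keeps the denominator positive even if the operator norm is
    0.\<close>
  define \<delta> where "\<delta> = 1 / (onorm R + 1)"
  have pos: "onorm R + 1 > 0"
    using onorm_pos_le[OF R] by simp
  then have "\<delta> > 0"
    by (simp add: \<delta>_def)
  have small: "cmod (lam - \<mu>) * onorm R < 1" if "\<mu> \<in> ball lam \<delta>" for \<mu>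
  proof -
    have "cmod (lam - \<mu>) * onorm R \<le> cmod (lam - \<mu>) * (onorm R + 1)"
      by (intro mult_left_mono) auto
    also have "\<dots> < 1"
      using that pos by (simp add: \<delta>_def dist_norm field_simps)
    finally show ?thesis .
  qed
  show ?thesis
  proof (intro exI[of _ \<delta>] conjI ballI)
    fix g
    assume g: "g \<in> wl2"
    define w where "w k = of_ell2 ((R ^^ Suc k) (to_ell2 g))" for k
    have w: "w k \<in> wl2" for k
      by (simp add: w_def of_ell2_in_wl2)
    have w0: "Lop p lam (w 0) = g"
      using w g AR by (simp add: Lop_eq_ell2_iff) (simp add: w_def to_of_ell2 A_def)
    have wS: "Lop p lam (w (Suc k)) = w k" for k
      using w AR by (simp add: Lop_eq_ell2_iff) (simp add: w_def to_of_ell2 A_def)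
    have uniq: "f = f'" if "\<mu> \<in> ball lam \<delta>" "A \<mu> f = A \<mu> f'" for \<mu> f f'
    proof -
      have "A \<mu> (f - f') = 0"
        using that A[of \<mu>] by (simp add: bounded_linear.linear linear_diff)
      then have "f - f' = 0"
        using resolvent_injective_ell2[OF R _ small[OF that(1)]] RA unfolding A_def by metis
      then show ?thesis
        by simp
    qed
    let ?t = "\<lambda>\<mu> k. scaleC_ell2 ((lam - \<mu>) ^ k) ((R ^^ Suc k) (to_ell2 g))"
    have sum: "summable (?t \<mu>)" and eq: "A \<mu> (suminf (?t \<mu>)) = to_ell2 g" if "\<mu> \<in> ball lam \<delta>" for \<mu>
      using neumann_series_ell2[OF bounded_linear_P_ell2 R _ P_ell2_scaleC small[OF that], of "to_ell2 g"] AR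
      unfolding A_def by blast+
    have sol: "f = of_ell2 (suminf (?t \<mu>))" if "\<mu> \<in> ball lam \<delta>" "f \<in> wl2" "Lop p \<mu> f = g" for \<mu> f
    proof -
      have "A \<mu> (to_ell2 f) = to_ell2 g"
        using that g by (simp add: A_def Lop_eq_ell2_iff)
      then have "to_ell2 f = suminf (?t \<mu>)"
        using uniq that eq by metis
      then show ?thesis
        using that by (metis of_to_ell2)
    qed
    have ex: "Lop p \<mu> (of_ell2 (suminf (?t \<mu>))) = g" if "\<mu> \<in> ball lam \<delta>" for \<mu>
      using eq[OF that] g by (simp add: A_def Lop_eq_ell2_iff of_ell2_in_wl2 to_of_ell2)
    have sums: "(\<lambda>k. (lam - \<mu>) ^ k * w k x) sums f x"
      if "\<mu> \<in> ball lam \<delta>" "f \<in> wl2" "Lop p \<mu> f = g" for \<mu> f x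
    proof -
      have "(\<lambda>k. apply_ell2 (?t \<mu> k) x) sums apply_ell2 (suminf (?t \<mu>)) x"
        by (rule bounded_linear.sums[OF bounded_linear_apply_ell2 summable_sums[OF sum[OF that(1)]]])
      then have "(\<lambda>k. apply_ell2 (?t \<mu> k) x / of_real (sqrt (m x))) sums f x"
        unfolding sol[OF that] of_ell2_def by (rule sums_divide)
      then show ?thesis
        by (simp add: w_def of_ell2_def apply_ell2_simps)
    qed
    have "resolvent_coeffs lam \<delta> g w"
      unfolding resolvent_coeffs_def
    proof (intro conjI allI ballI impI)
      show "\<exists>f\<in>wl2. Lop p \<mu> f = g" if "\<mu> \<in> ball lam \<delta>" for \<mu>
        using ex[OF that] of_ell2_in_wl2 by blast
    qed (use w w0 wS sums in auto)
    then show "\<exists>w. resolvent_coeffs lam \<delta> g w"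
      by blast
  qed (rule \<open>\<delta> > 0\<close>)
qed

end

section \<open>Rooted trees and their ends\<close>

lemma is_walk_iff_successively: "is_walk adj xs \<longleftrightarrow> xs \<noteq> [] \<and> successively adj xs"
  by (simp add: is_walk_def successively_conv_nth)

locale rooted_tree =
  fixes adj :: "'v \<Rightarrow> 'v \<Rightarrow> bool" and rt :: 'v
  assumes tree: "is_tree adj" and no_leaves: "no_leaves adj"
begin

abbreviation path :: "'v \<Rightarrow> 'v list" where "path \<equiv> geod adj rt"
abbreviation par :: "'v \<Rightarrow> 'v" where "par \<equiv> parent adj rt"
abbreviation kids :: "'v \<Rightarrow> 'v set" where "kids \<equiv> children adj rt"
abbreviation anc :: "'v \<Rightarrow> 'v set" where "anc x \<equiv> set (path x)"

section \<open>Geodesics from the root, parents and children\<close>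

lemma adj_sym: "adj x y \<Longrightarrow> adj y x"
  by (rule tree[unfolded is_tree_def, THEN conjunct1, rule_format])

lemma ex1_simple_path: "\<exists>!xs. is_simple_path adj x y xs"
  by (rule tree[unfolded is_tree_def, THEN conjunct2, THEN conjunct2, rule_format])

lemma simple_path_path: "is_simple_path adj rt x (path x)"
  unfolding geod_def by (rule theI'[OF ex1_simple_path])

lemma path_eqI: "is_simple_path adj rt x xs \<Longrightarrow> path x = xs"
  unfolding geod_def by (rule the1_equality[OF ex1_simple_path])

lemma adj_irrefl: "\<not> adj x x"
  by (rule tree[unfolded is_tree_def, THEN conjunct2, THEN conjunct1, rule_format])

lemma path_facts:
  "path x \<noteq> []" "successively adj (path x)" "distinct (path x)" "hd (path x) = rt" "last (path x) = x"
  using simple_path_path[of x] by (auto simp: is_simple_path_def is_walk_iff_successively)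

lemma self_in_anc: "x \<in> anc x"
  using path_facts[of x] last_in_set by metis

lemma path_root: "path rt = [rt]"
  by (rule path_eqI) (simp add: is_simple_path_def is_walk_def)

text \<open>An initial segment of a simple path from the root is simple, and simple paths are
  unique.\<close>

lemma path_prefix:
  assumes "path x = as @ y # bs"
  shows "path y = as @ [y]"
proof (rule path_eqI)
  have "successively adj ((as @ [y]) @ bs)" "distinct ((as @ [y]) @ bs)" "hd ((as @ [y]) @ bs) = rt"
    using path_facts[of x] assms by auto
  then show "is_simple_path adj rt y (as @ [y])"
    unfolding is_simple_path_def is_walk_iff_successively successively_append_iff by (auto simp: hd_append)
qed

lemma anc_trans: "u \<in> anc v \<Longrightarrow> v \<in> anc x \<Longrightarrow> u \<in> anc x"
proof -
  assume u: "u \<in> anc v" and "v \<in> anc x"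
  then obtain as bs where "path x = as @ v # bs"
    by (meson split_list)
  then show "u \<in> anc x"
    using path_prefix[of x as v bs] u by auto
qed

lemma path_extend:
  assumes "adj x y" "y \<notin> anc x"
  shows "path y = path x @ [y]"
  using path_facts[of x] assms
  by (intro path_eqI) (auto simp: is_simple_path_def is_walk_iff_successively successively_append_iff)

text \<open>If \<open>y\<close> is off the geodesic to \<open>x\<close>, that geodesic extends to
  \<open>y\<close>. Otherwise the geodesic to \<open>y\<close> is a proper prefix avoiding
  \<open>x\<close>, and it extends to \<open>x\<close>.\<close>

lemma adj_path_cases:
  assumes "adj x y"
  shows "path y = path x @ [y] \<or> path x = path y @ [x]"
proof (cases "y \<in> anc x")
  case True
  then obtain as bs where x: "path x = as @ y # bs"
    by (meson split_list)
  then have y: "path y = as @ [y]"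
    by (rule path_prefix)
  have "x \<noteq> y"
    using assms adj_irrefl by blast
  then have "bs \<noteq> []" "last bs = x"
    using x path_facts(5)[of x] by (auto split: if_splits)
  then have "x \<in> set bs"
    using last_in_set by metis
  then have "x \<notin> anc y"
    using path_facts(3)[of x] unfolding x y by auto
  then show ?thesis
    using path_extend[of y x] assms adj_sym by blast
qed (use assms path_extend in blast)

lemma par_eqI:
  assumes "path y = path x @ [y]"
  shows "par y = x"
  unfolding parent_def
proof (rule the_equality)
  have "successively adj (path x @ [y])"
    using path_facts(2)[of y] assms by simp
  then show "adj x y \<and> x \<in> anc y"
    using path_facts[of x] self_in_anc[of x] assms by (auto simp: successively_append_iff)
  fix z
  assume z: "adj z y \<and> z \<in> anc y"
  have "path y = path z @ [y]"
    using z adj_path_cases[of z y] path_facts(3)[of z] by auto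
  then have "path z = path x"
    using assms by simp
  then show "z = x"
    using path_facts(5) by metis
qed

lemma path_non_root:
  assumes "y \<noteq> rt"
  shows "path y = path (par y) @ [y]"
proof -
  have "path y = butlast (path y) @ [y]"
    using path_facts[of y] by (metis append_butlast_last_id)
  moreover have "butlast (path y) \<noteq> []"
    using calculation path_facts(4)[of y] assms by (metis append_Nil list.sel(1))
  ultimately obtain as x where "path y = as @ [x, y]"
    by (metis append_butlast_last_id append.assoc append_Cons append_Nil)
  then have y: "path y = path x @ [y]"
    using path_prefix[of y as x "[y]"] by simp
  then show ?thesis
    using par_eqI by simp
qed

lemma kids_iff: "y \<in> kids x \<longleftrightarrow> path y = path x @ [y]"
proof
  assume "y \<in> kids x"
  then show "path y = path x @ [y]"
    using path_non_root[of y] by (simp add: children_def)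
next
  assume y: "path y = path x @ [y]"
  then have "y \<noteq> rt"
    using path_root path_facts(1)[of x] by auto
  then show "y \<in> kids x"
    using par_eqI[OF y] by (simp add: children_def)
qed

lemma kids_par: "y \<noteq> rt \<Longrightarrow> y \<in> kids (par y)"
  by (simp add: children_def)

lemma kids_anc: "y \<in> kids x \<Longrightarrow> anc y = insert y (anc x)"
  by (simp add: kids_iff)

lemma kids_not_anc: "y \<in> kids x \<Longrightarrow> y \<notin> anc x"
  using path_facts(3)[of y] by (auto simp: kids_iff)

lemma adj_iff: "adj x y \<longleftrightarrow> y \<in> kids x \<or> x \<in> kids y"
proof
  show "adj x y" if "y \<in> kids x \<or> x \<in> kids y"
  proof -
    have "adj x y" if "y \<in> kids x" for x y
      using that path_facts(1,2,5) unfolding kids_iff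
      by (metis list.sel(1) not_Cons_self2 successively_append_iff)
    then show ?thesis
      using that adj_sym by blast
  qed
qed (auto simp: kids_iff dest: adj_path_cases)

lemma par_in_anc: "z \<in> anc x \<Longrightarrow> z \<noteq> rt \<Longrightarrow> par z \<in> anc x"
  using anc_trans[of "par z" z x] path_non_root[of z] self_in_anc[of "par z"] by auto

lemma anc_root: "anc rt = {rt}"
  by (simp add: path_root)

lemma kids_ne_root: "y \<in> kids x \<Longrightarrow> y \<noteq> rt"
  by (simp add: children_def)

lemma kids_imp_par: "y \<in> kids x \<Longrightarrow> par y = x"
  by (simp add: children_def)

lemma root_in_anc: "rt \<in> anc x"
  using path_facts[of x] hd_in_set by metis

lemma anc_par_ne: "z \<in> anc x \<Longrightarrow> z \<noteq> rt \<Longrightarrow> par z \<noteq> x"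
  using kids_par[of z] kids_not_anc by blast

lemma par_not_below:
  assumes "v \<noteq> rt"
  shows "v \<notin> anc (par v)" "par v \<noteq> v"
proof -
  show "v \<notin> anc (par v)"
    by (rule kids_not_anc[OF kids_par[OF assms]])
  then show "par v \<noteq> v"
    using self_in_anc[of v] by auto
qed

text \<open>Every edge joins a parent and a child, and the child's ancestors are those of the parent
  together with the child itself. Hence the only edge leaving the branch at \<open>v\<close> is the
  one above \<open>v\<close>.\<close>

lemma cut_edge:
  assumes "adj a b" "v \<in> anc a" "v \<notin> anc b"
  shows "v \<noteq> rt" "a = v" "b = par v"
proof -
  show "v \<noteq> rt"
    using assms root_in_anc by blast
  have "a \<in> kids b"
    using assms kids_anc by (auto simp: adj_iff)
  then show "a = v" "b = par v"
    using assms kids_anc[of a b] kids_imp_par by auto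
qed

lemma tree_induct [case_names root child]:
  assumes "P rt" "\<And>x y. y \<in> kids x \<Longrightarrow> P x \<Longrightarrow> P y"
  shows "P z"
proof (induction "length (path z)" arbitrary: z rule: less_induct)
  case less
  show ?case
  proof (cases "z = rt")
    case False
    then have "P (par z)"
      using path_non_root[of z] by (intro less) simp
    then show ?thesis
      using assms(2) kids_par False by blast
  qed (simp add: assms)
qed

text \<open>Of two distinct neighbours at most one is the parent.\<close>

lemma kids_nonempty: "\<exists>y. y \<in> kids x"
proof -
  obtain y z where yz: "adj x y" "adj x z" "y \<noteq> z"
    using no_leaves unfolding no_leaves_def by blast
  then have "y \<in> kids x \<or> z \<in> kids x"
    using kids_imp_par[of x y] kids_imp_par[of x z] by (auto simp: adj_iff)
  then show ?thesis
    by blast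
qed

section \<open>Rays, boundary sets and integrals along a geodesic\<close>

lemma path_ray:
  assumes "\<xi> \<in> ends adj rt"
  shows "path (\<xi> n) = map \<xi> [0..<Suc n]"
proof (rule path_eqI)
  have "distinct (map \<xi> [0..<Suc n])"
    using assms by (simp add: ends_def distinct_map inj_on_subset[of \<xi> UNIV] del: upt_Suc)
  moreover have "is_walk adj (map \<xi> [0..<Suc n])"
    using assms unfolding is_walk_def ends_def by (auto simp del: upt_Suc)
  ultimately show "is_simple_path adj rt (\<xi> n) (map \<xi> [0..<Suc n])"
    using assms unfolding is_simple_path_def ends_def by (auto simp: hd_map simp del: upt_Suc) simp
qed

lemma anc_ray: "\<xi> \<in> ends adj rt \<Longrightarrow> anc (\<xi> n) = \<xi> ` {..n}"
  by (simp add: path_ray atLeast0LessThan lessThan_Suc_atMost del: upt_Suc)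

lemma kids_ray: "\<xi> \<in> ends adj rt \<Longrightarrow> \<xi> (Suc n) \<in> kids (\<xi> n)"
  by (simp add: path_ray kids_iff)

lemma ends_iff: "\<xi> \<in> ends adj rt \<longleftrightarrow> \<xi> 0 = rt \<and> (\<forall>n. \<xi> (Suc n) \<in> kids (\<xi> n))"
proof
  assume \<xi>: "\<xi> 0 = rt \<and> (\<forall>n. \<xi> (Suc n) \<in> kids (\<xi> n))"
  have "length (path (\<xi> n)) = Suc n" for n
    using \<xi> by (induction n) (auto simp: path_root kids_iff)
  then have "inj \<xi>"
    by (metis Suc_inject injI)
  then show "\<xi> \<in> ends adj rt"
    using \<xi> by (auto simp: ends_def adj_iff)
next
  assume \<xi>: "\<xi> \<in> ends adj rt"
  then show "\<xi> 0 = rt \<and> (\<forall>n. \<xi> (Suc n) \<in> kids (\<xi> n))"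
    using kids_ray by (auto simp: ends_def)
qed

lemma bdy_nonempty: "\<exists>\<xi>. \<xi> \<in> bdy adj rt z"
proof -
  obtain s where s: "\<And>x. s x \<in> kids x"
    using kids_nonempty by metis
  have "\<exists>\<xi> k. \<xi> \<in> ends adj rt \<and> \<xi> k = z"
  proof (induction z rule: tree_induct)
    case root
    show ?case
      using s by (intro exI[of _ "\<lambda>n. (s ^^ n) rt"] exI[of _ 0]) (auto simp: ends_iff)
  next
    case (child x y)
    then obtain \<xi> k where \<xi>: "\<xi> \<in> ends adj rt" "\<xi> k = x"
      by blast
    \<comment> \<open>The old ray is followed up to \<open>x\<close> at index \<open>k\<close>, then
      \<open>y\<close> is visited at index \<open>Suc k\<close>, and from there the chosen children
      \<open>s\<close> are iterated.\<close>
    define \<xi>' where "\<xi>' n = (if n \<le> k then \<xi> n else (s ^^ (n - Suc k)) y)" for n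
    have "\<xi>' (Suc n) \<in> kids (\<xi>' n)" for n
    proof (cases n k rule: linorder_cases)
      case less
      then show ?thesis
        using \<xi> by (simp add: \<xi>'_def ends_iff)
    next
      case equal
      then show ?thesis
        using \<xi> child by (simp add: \<xi>'_def)
    next
      case greater
      then have "Suc n - Suc k = Suc (n - Suc k)"
        by simp
      then show ?thesis
        using greater s by (simp add: \<xi>'_def)
    qed
    then have "\<xi>' \<in> ends adj rt"
      using \<xi> by (simp add: ends_iff \<xi>'_def)
    moreover have "\<xi>' (Suc k) = y"
      by (simp add: \<xi>'_def)
    ultimately show ?case
      by blast
  qed
  then show ?thesis
    by (auto simp: bdy_def)
qed

text \<open>The length of the geodesic to a vertex fixes its index on any ray through it, so a ray
  at \<open>x\<close> at time \<open>k\<close> can meet a child of \<open>x\<close> only at time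
  \<open>Suc k\<close>.\<close>

lemma bdy_kid_unique:
  assumes "\<xi> \<in> bdy adj rt y" "y \<in> kids x" "\<xi> k = x"
  shows "y = \<xi> (Suc k)"
proof -
  obtain j where j: "\<xi> \<in> ends adj rt" "\<xi> j = y"
    using assms by (auto simp: bdy_def)
  then have "length (path y) = Suc j" "length (path x) = Suc k"
    using assms path_ray[OF j(1), of j] path_ray[OF j(1), of k] by auto
  then show ?thesis
    using assms j by (auto simp: kids_iff)
qed

lemma bdy_kid_subset:
  assumes "y \<in> kids x"
  shows "bdy adj rt y \<subseteq> bdy adj rt x"
proof
  fix \<xi>
  assume "\<xi> \<in> bdy adj rt y"
  then obtain j where j: "\<xi> \<in> ends adj rt" "\<xi> j = y"
    by (auto simp: bdy_def)
  then have "x \<in> \<xi> ` {..j}"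
    using anc_ray[of \<xi> j] kids_anc[OF assms] self_in_anc[of x] by auto
  then show "\<xi> \<in> bdy adj rt x"
    using j by (auto simp: bdy_def)
qed

text \<open>The ray passes through \<open>z\<close>, and its next vertex is not an ancestor of
  \<open>x\<close>. No later vertex is one either, since ancestors of ancestors are
  ancestors.\<close>

lemma confl_eq:
  assumes z: "z \<in> anc x"
    and \<xi>: "\<xi> \<in> bdy adj rt z - (\<Union>y\<in>anc x \<inter> kids z. bdy adj rt y)"
  shows "confl adj rt x \<xi> = z"
proof -
  obtain k where k: "\<xi> \<in> ends adj rt" "\<xi> k = z"
    using \<xi> by (auto simp: bdy_def)
  have "(GREATEST j. \<xi> j \<in> anc x) = k"
  proof (rule Greatest_equality)
    show "\<xi> k \<in> anc x"
      using k z by simp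
    fix j
    assume j: "\<xi> j \<in> anc x"
    show "j \<le> k"
    proof (rule ccontr)
      assume "\<not> j \<le> k"
      then have "\<xi> (Suc k) \<in> anc (\<xi> j)"
        using anc_ray[OF k(1)] by auto
      then have "\<xi> (Suc k) \<in> anc x \<inter> kids z"
        using anc_trans j kids_ray[OF k(1)] k by blast
      then show False
        using \<xi> k by (auto simp: bdy_def)
    qed
  qed
  then show ?thesis
    using k by (simp add: confl_def)
qed

text \<open>If no end leaves \<open>anc x\<close> at \<open>z\<close>, then the only child of \<open>z\<close> lies in \<open>anc x\<close>.\<close>

lemma cdist_weight_zero:
  assumes \<nu>: "cdist adj rt \<nu>"
    and empty: "bdy adj rt z - (\<Union>y\<in>anc x \<inter> kids z. bdy adj rt y) = {}"
  shows "\<nu> z - (\<Sum>y\<in>anc x \<inter> kids z. \<nu> y) = 0"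
proof -
  have "kids z \<subseteq> anc x"
  proof
    fix y
    assume y: "y \<in> kids z"
    obtain \<xi> where \<xi>: "\<xi> \<in> bdy adj rt y"
      using bdy_nonempty by blast
    then have "\<xi> \<in> bdy adj rt z"
      using bdy_kid_subset[OF y] by blast
    then obtain y' where y': "y' \<in> anc x \<inter> kids z" "\<xi> \<in> bdy adj rt y'"
      using empty by auto
    obtain k where "\<xi> k = z"
      using \<open>\<xi> \<in> bdy adj rt z\<close> by (auto simp: bdy_def)
    then show "y \<in> anc x"
      using bdy_kid_unique[OF \<xi> y] bdy_kid_unique[of \<xi> y' z k] y' by auto
  qed
  then have "anc x \<inter> kids z = kids z" "finite (kids z)"
    using finite_subset[of "kids z" "anc x"] by auto
  then show ?thesis
    using \<nu> has_sum_unique[OF _ has_sum_finite[of "kids z" \<nu>], of "\<nu> z"] by (simp add: cdist_def)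
qed

text \<open>Summation by parts: collecting the terms with \<open>\<nu> z\<close> leaves the
  increment of \<psi> from the parent of \<open>z\<close> to \<open>z\<close>. Where the set behind
  \<open>SOME\<close> is empty, the arbitrary value is multiplied by weight 0.\<close>

lemma loc_integral_path:
  assumes \<nu>: "cdist adj rt \<nu>" and \<phi>: "\<And>\<xi>. \<phi> \<xi> = \<psi> (confl adj rt x \<xi>)"
  shows "loc_integral adj rt (anc x) \<phi> \<nu>
    = (\<Sum>z\<in>anc x. (\<psi> z - (if z = rt then 0 else \<psi> (par z))) * \<nu> z)"
proof -
  have "loc_integral adj rt (anc x) \<phi> \<nu> = (\<Sum>z\<in>anc x. \<psi> z * (\<nu> z - (\<Sum>y\<in>anc x \<inter> kids z. \<nu> y)))"
    unfolding loc_integral_def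
  proof (rule sum.cong)
    fix z
    assume z: "z \<in> anc x"
    let ?B = "bdy adj rt z - (\<Union>y\<in>anc x \<inter> kids z. bdy adj rt y)"
    show "\<phi> (SOME \<xi>. \<xi> \<in> ?B) * (\<nu> z - (\<Sum>y\<in>anc x \<inter> kids z. \<nu> y)) = \<psi> z * (\<nu> z - (\<Sum>y\<in>anc x \<inter> kids z. \<nu> y))"
    proof (cases "?B = {}")
      case True
      then show ?thesis
        using cdist_weight_zero[OF \<nu>] by simp
    next
      case False
      then have "(SOME \<xi>. \<xi> \<in> ?B) \<in> ?B"
        by (rule some_in_eq[THEN iffD2])
      then show ?thesis
        using confl_eq[OF z] \<phi> by simp
    qed
  qed simp
  also have "\<dots> = (\<Sum>z\<in>anc x. \<psi> z * \<nu> z) - (\<Sum>z\<in>anc x. \<Sum>y\<in>anc x \<inter> kids z. \<psi> z * \<nu> y)"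
    by (simp add: right_diff_distrib sum_subtractf sum_distrib_left)
  \<comment> \<open>The sum over parent-child pairs is rewritten over all pairs of ancestors, so
    that it can be exchanged; each \<open>y\<close> other than the root then has a single partner
    \<open>par y\<close>.\<close>
  also have "(\<Sum>z\<in>anc x. \<Sum>y\<in>anc x \<inter> kids z. \<psi> z * \<nu> y)
      = (\<Sum>z\<in>anc x. \<Sum>y\<in>anc x. if z = par y \<and> y \<noteq> rt then \<psi> z * \<nu> y else 0)"
    by (rule sum.cong[OF refl], rule sum.mono_neutral_cong_left) (auto simp: children_def)
  also have "\<dots> = (\<Sum>y\<in>anc x. \<Sum>z\<in>anc x. if z = par y \<and> y \<noteq> rt then \<psi> z * \<nu> y else 0)"
    by (rule sum.swap)
  also have "\<dots> = (\<Sum>y\<in>anc x. (if y = rt then 0 else \<psi> (par y)) * \<nu> y)"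
  proof (rule sum.cong)
    fix y
    assume "y \<in> anc x"
    then show "(\<Sum>z\<in>anc x. if z = par y \<and> y \<noteq> rt then \<psi> z * \<nu> y else 0)
        = (if y = rt then 0 else \<psi> (par y)) * \<nu> y"
      using par_in_anc[of y x] by (cases "y = rt") (auto simp: sum.delta)
  qed simp
  finally show ?thesis
    by (simp add: left_diff_distrib sum_subtractf)
qed

end

section \<open>Triangular representation of polyharmonic functions\<close>

text \<open>Summability and absolute summability coincide for complex families, so any
  \<open>has_sum\<close> fact for the weighted family yields \<open>Pdefined\<close>.\<close>

lemma Pdefined_iff: "Pdefined p f \<longleftrightarrow> (\<forall>x. (\<lambda>y. complex_of_real (p x y) * f y) summable_on UNIV)"
  unfolding Pdefined_def summable_on_iff_abs_summable_on_complex ..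

lemma has_sum_Pop: "Pdefined p f \<Longrightarrow> ((\<lambda>y. complex_of_real (p x y) * f y) has_sum Pop p f x) UNIV"
  by (simp add: Pdefined_iff Pop_def)

lemma Pop_eqI: "((\<lambda>y. complex_of_real (p x y) * f y) has_sum s) UNIV \<Longrightarrow> Pop p f x = s"
  by (simp add: Pop_def infsumI)

lemma Pdefined_zero: "Pdefined p (\<lambda>_. 0)"
  by (simp add: Pdefined_iff)

lemma Pdefined_add: "Pdefined p f \<Longrightarrow> Pdefined p g \<Longrightarrow> Pdefined p (\<lambda>x. f x + g x)"
  by (simp add: Pdefined_iff distrib_left summable_on_add)

lemma Pdefined_cmult: "Pdefined p f \<Longrightarrow> Pdefined p (\<lambda>x. a * f x)"
  unfolding Pdefined_iff mult.left_commute[of _ a] by (intro allI summable_on_cmult_right) auto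

lemma Pdefined_diff: "Pdefined p f \<Longrightarrow> Pdefined p g \<Longrightarrow> Pdefined p (\<lambda>x. f x - g x)"
  using Pdefined_add[of p f "\<lambda>x. -1 * g x"] Pdefined_cmult[of p g "-1"] by simp

lemma Pdefined_sum: "(\<And>i. i \<in> I \<Longrightarrow> Pdefined p (f i)) \<Longrightarrow> Pdefined p (\<lambda>x. \<Sum>i\<in>I. f i x)"
  by (induction I rule: infinite_finite_induct) (auto intro: Pdefined_add Pdefined_zero)

lemma Lop_add:
  "Pdefined p f \<Longrightarrow> Pdefined p g \<Longrightarrow> Lop p lam (\<lambda>x. f x + g x) x = Lop p lam f x + Lop p lam g x"
  by (simp add: Lop_def Pop_add algebra_simps)

lemma Lop_cmult: "Lop p lam (\<lambda>x. a * f x) x = a * Lop p lam f x"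
  by (simp add: Lop_def Pop_cmult algebra_simps)

lemma Lop_diff:
  "Pdefined p f \<Longrightarrow> Pdefined p g \<Longrightarrow> Lop p lam (\<lambda>x. f x - g x) x = Lop p lam f x - Lop p lam g x"
  using Lop_add[of p f "\<lambda>x. -1 * g x"] Pdefined_cmult[of p g "-1"] Lop_cmult[of p lam "-1" g] by simp

lemma Lop_zero: "Lop p lam (\<lambda>_. 0) x = 0"
  by (simp add: Lop_def Pop_def)

lemma Lop_sum:
  "(\<And>i. i \<in> I \<Longrightarrow> Pdefined p (f i)) \<Longrightarrow> Lop p lam (\<lambda>x. \<Sum>i\<in>I. f i x) x = (\<Sum>i\<in>I. Lop p lam (f i) x)"
  by (induction I rule: infinite_finite_induct) (auto simp: Lop_add Pdefined_sum Lop_zero)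

lemma polyharmonic_0: "polyharmonic p lam 0 f \<longleftrightarrow> f = (\<lambda>_. 0)"
  by (simp add: polyharmonic_def)

lemma polyharmonic_Suc:
  "polyharmonic p lam (Suc n) f \<longleftrightarrow> Pdefined p f \<and> polyharmonic p lam n (Lop p lam f)"
  unfolding polyharmonic_def by (simp add: All_less_Suc2 funpow_swap1)

lemma cdist_cmult: "cdist adj rt \<nu> \<Longrightarrow> cdist adj rt (\<lambda>x. a * \<nu> x)"
  unfolding cdist_def by (auto simp: norm_mult intro: summable_on_cmult_right has_sum_cmult_right)

lemma cdist_iff: "cdist adj rt \<nu> \<longleftrightarrow> (\<forall>x. (\<nu> has_sum \<nu> x) (children adj rt x))"
  unfolding cdist_def summable_on_iff_abs_summable_on_complex[symmetric]
  using has_sum_imp_summable by blast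

text \<open>Here \<open>kd r v\<close> and \<open>c r v\<close> stand for the \<open>r\<close>-th derivatives in \<open>\<lambda>\<close> of \<open>G(\<cdot>, v) / G(o, v)\<close> and
  \<open>1 / G(o, v)\<close>.\<close>

locale kernel_tree = rooted_tree adj rt for adj :: "'v \<Rightarrow> 'v \<Rightarrow> bool" and rt +
  fixes p :: "'v \<Rightarrow> 'v \<Rightarrow> real" and lam :: complex
    and kd :: "nat \<Rightarrow> 'v \<Rightarrow> 'v \<Rightarrow> complex" and c :: "nat \<Rightarrow> 'v \<Rightarrow> complex"
  assumes sto: "stochastic adj p"
    and kd_off: "v \<noteq> rt \<Longrightarrow> v \<notin> anc x \<Longrightarrow> kd r v x = kd r (par v) x"
    and Pdefined_kd: "Pdefined p (kd r v)"
    and Lop_kd: "Lop p lam (kd r v) x = (if x = v then c r v else 0) - of_nat r * kd (r - 1) v x"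
    and c_nonzero: "c 0 v \<noteq> 0"
    and kd_root: "kd 0 rt rt \<noteq> 0"
begin

text \<open>The kernel increment across the edge above \<open>v\<close>, with 0 in place of the
  missing parent term at the root. These are the coefficients produced by summation by
  parts.\<close>

definition D :: "nat \<Rightarrow> 'v \<Rightarrow> 'v \<Rightarrow> complex" where
  "D r v x = kd r v x - (if v = rt then 0 else kd r (par v) x)"

definition J :: "nat \<Rightarrow> ('v \<Rightarrow> complex) \<Rightarrow> 'v \<Rightarrow> complex" where
  "J r \<nu> x = (\<Sum>z\<in>anc x. D r z x * \<nu> z)"

lemma p_pos_iff: "p x y \<noteq> 0 \<longleftrightarrow> adj x y"
  using sto unfolding stochastic_def by (metis less_eq_real_def order_less_irrefl)

lemma D_off: "v \<notin> anc x \<Longrightarrow> D r v x = 0"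
  using kd_off[of v x r] root_in_anc by (auto simp: D_def)

lemma Pdefined_D: "Pdefined p (D r v)"
proof (cases "v = rt")
  case True
  then show ?thesis
    using Pdefined_kd[of r rt] by (simp add: D_def[abs_def])
next
  case False
  then show ?thesis
    using Pdefined_diff[OF Pdefined_kd[of r v] Pdefined_kd[of r "par v"]] by (simp add: D_def[abs_def])
qed

text \<open>The two point sources come from the kernels at \<open>v\<close> and at its parent. For
  \<open>r = 0\<close> the truncated \<open>r - 1\<close> does no harm because of the factor
  \<open>of_nat r\<close>.\<close>

lemma Lop_D:
  "Lop p lam (D r v) x = (if x = v then c r v else 0) - (if v \<noteq> rt \<and> x = par v then c r x else 0)
    - of_nat r * D (r - 1) v x"
proof (cases "v = rt")
  case True
  then show ?thesis
    using Lop_kd[of r rt] by (simp add: D_def[abs_def])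
next
  case False
  then show ?thesis
    using Lop_diff[OF Pdefined_kd[of r v] Pdefined_kd[of r "par v"], of lam x]
    by (simp add: D_def[abs_def] Lop_kd) (simp add: algebra_simps)
qed

text \<open>At the parent \<open>x\<close> the function \<open>D r y\<close> vanishes, and
  \<open>y\<close> is the only neighbour of \<open>x\<close> where it need not. So
  \<open>\<lambda>I - P\<close> at \<open>x\<close> reduces to a single term, which must balance the
  source \<open>- c r x\<close>.\<close>

lemma D_diagonal:
  assumes y: "y \<in> kids x"
  shows "complex_of_real (p x y) * D r y y = c r x"
proof -
  have "y \<notin> anc x" "y \<noteq> rt" "par y = x" "x \<noteq> y"
    using y kids_not_anc kids_ne_root kids_imp_par self_in_anc by blast+
  then have "Lop p lam (D r y) x = - c r x"
    by (simp add: Lop_D D_off)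
  moreover have "Pop p (D r y) x = complex_of_real (p x y) * D r y y"
  proof (rule Pop_eqI)
    have "complex_of_real (p x z) * D r y z = 0" if "z \<noteq> y" for z
    proof (rule ccontr)
      assume "complex_of_real (p x z) * D r y z \<noteq> 0"
      then have "adj x z" "y \<in> anc z"
        using p_pos_iff[of x z] D_off[of y z r] by auto
      then show False
        using cut_edge(2)[of z x y] adj_sym \<open>y \<notin> anc x\<close> that by blast
    qed
    then show "((\<lambda>z. complex_of_real (p x z) * D r y z) has_sum complex_of_real (p x y) * D r y y) UNIV"
      by (intro has_sum_finite_neutralI[of "{y}"]) auto
  qed
  ultimately show ?thesis
    using \<open>y \<notin> anc x\<close> by (simp add: Lop_def D_off)
qed

lemma D_diagonal_nonzero: "D 0 v v \<noteq> 0"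
proof (cases "v = rt")
  case True
  then show ?thesis
    by (simp add: D_def kd_root)
next
  case False
  then show ?thesis
    using D_diagonal[OF kids_par[OF False], of 0] c_nonzero[of "par v"] by auto
qed

text \<open>Isolates the infinite sum over the children. Passing to a child \<open>y\<close> adds
  one diagonal term, whose weight \<open>c r x\<close> is the same for all children; passing to the
  parent drops the term at \<open>x\<close>, which vanishes there.\<close>

lemma p_J_split:
  "complex_of_real (p x y) * J r \<nu> y
    = (\<Sum>z\<in>anc x. \<nu> z * (complex_of_real (p x y) * D r z y)) + (if y \<in> kids x then c r x * \<nu> y else 0)"
proof -
  consider "y \<in> kids x" | "x \<in> kids y" | "\<not> adj x y"
    using adj_iff by blast
  then show ?thesis
  proof cases
    case 1
    then have "J r \<nu> y = D r y y * \<nu> y + (\<Sum>z\<in>anc x. D r z y * \<nu> z)"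
      using kids_not_anc[OF 1] by (simp add: J_def kids_anc[OF 1])
    then have "complex_of_real (p x y) * J r \<nu> y
        = (complex_of_real (p x y) * D r y y) * \<nu> y + (\<Sum>z\<in>anc x. complex_of_real (p x y) * (D r z y * \<nu> z))"
      by (simp add: distrib_left sum_distrib_left mult.assoc)
    then show ?thesis
      using 1 by (simp add: D_diagonal mult_ac)
  next
    case 2
    then have "y \<notin> kids x"
      using kids_anc kids_not_anc self_in_anc by blast
    moreover have "x \<notin> anc y"
      using kids_not_anc[OF 2] .
    moreover have "(\<Sum>z\<in>anc x. \<nu> z * (complex_of_real (p x y) * D r z y))
        = (\<Sum>z\<in>anc y. \<nu> z * (complex_of_real (p x y) * D r z y))"
      using \<open>x \<notin> anc y\<close> D_off by (simp add: kids_anc[OF 2])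
    ultimately show ?thesis
      by (simp add: J_def sum_distrib_left mult_ac)
  next
    case 3
    then show ?thesis
      using p_pos_iff[of x y] adj_iff[of x y] by auto
  qed
qed

lemma has_sum_D_part:
  "((\<lambda>y. \<Sum>z\<in>anc x. \<nu> z * (complex_of_real (p x y) * D r z y))
    has_sum (\<Sum>z\<in>anc x. \<nu> z * Pop p (D r z) x)) UNIV"
  by (intro has_sum_sum has_sum_cmult_right has_sum_Pop Pdefined_D)

lemma has_sum_kids_part:
  "((\<lambda>y. if y \<in> kids x then a * \<nu> y else 0) has_sum s) UNIV \<longleftrightarrow> ((\<lambda>y. a * \<nu> y) has_sum s) (kids x)"
  by (rule has_sum_cong_neutral) auto

lemma Lop_D_part:
  "lam * J r \<nu> x - (\<Sum>z\<in>anc x. \<nu> z * Pop p (D r z) x) = c r x * \<nu> x - of_nat r * J (r - 1) \<nu> x"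
proof -
  have "lam * J r \<nu> x - (\<Sum>z\<in>anc x. \<nu> z * Pop p (D r z) x) = (\<Sum>z\<in>anc x. \<nu> z * Lop p lam (D r z) x)"
    by (simp add: J_def Lop_def sum_distrib_left sum_subtractf right_diff_distrib mult_ac)
  also have "\<dots> = (\<Sum>z\<in>anc x. (if z = x then c r x * \<nu> x else 0) - of_nat r * (D (r - 1) z x * \<nu> z))"
  proof (rule sum.cong)
    fix z
    assume "z \<in> anc x"
    \<comment> \<open>The second source of \<open>D r z\<close> sits at the parent of
      \<open>z\<close>, which is never \<open>x\<close> when \<open>z\<close> is an ancestor of
      \<open>x\<close>.\<close>
    then have "\<not> (z \<noteq> rt \<and> x = par z)"
      using anc_par_ne by blast
    then show "\<nu> z * Lop p lam (D r z) x = (if z = x then c r x * \<nu> x else 0) - of_nat r * (D (r - 1) z x * \<nu> z)"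
      by (simp only: Lop_D if_False) (auto simp: algebra_simps)
  qed simp
  also have "\<dots> = c r x * \<nu> x - of_nat r * J (r - 1) \<nu> x"
    using self_in_anc[of x] by (simp add: sum_subtractf J_def sum_distrib_left)
  finally show ?thesis .
qed

text \<open>For a distribution, the children contribute \<open>c r x * \<nu> x\<close> to
  \<open>P\<close> at \<open>x\<close>, which cancels the point source left in
  \<open>Lop_D_part\<close>.\<close>

lemma
  assumes "cdist adj rt \<nu>"
  shows Pdefined_J: "Pdefined p (J r \<nu>)"
    and Lop_J: "Lop p lam (J r \<nu>) x = - of_nat r * J (r - 1) \<nu> x"
proof -
  have *: "((\<lambda>y. complex_of_real (p x y) * J r \<nu> y)
      has_sum (\<Sum>z\<in>anc x. \<nu> z * Pop p (D r z) x) + c r x * \<nu> x) UNIV" for x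
    unfolding p_J_split using assms
    by (intro has_sum_add has_sum_D_part has_sum_kids_part[THEN iffD2] has_sum_cmult_right)
      (simp add: cdist_iff)
  then show "Pdefined p (J r \<nu>)"
    using has_sum_imp_summable by (auto simp: Pdefined_iff)
  show "Lop p lam (J r \<nu>) x = - of_nat r * J (r - 1) \<nu> x"
    using Pop_eqI[OF *] Lop_D_part[of r \<nu> x] by (simp add: Lop_def algebra_simps)
qed

text \<open>Subtracting the finitely many convergent ancestor series from the convergent series for
  \<open>P\<close> leaves the series over the children. Harmonicity identifies its sum, and
  \<open>c 0 x\<close> can be divided out.\<close>

lemma cdist_if_J_harmonic:
  assumes def: "Pdefined p (J 0 \<nu>)" and harm: "\<And>x. Lop p lam (J 0 \<nu>) x = 0"
  shows "cdist adj rt \<nu>"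
  unfolding cdist_iff
proof
  fix x
  let ?B = "\<Sum>z\<in>anc x. \<nu> z * Pop p (D 0 z) x"
  have "((\<lambda>y. complex_of_real (p x y) * J 0 \<nu> y
      + -1 * (\<Sum>z\<in>anc x. \<nu> z * (complex_of_real (p x y) * D 0 z y))) has_sum (Pop p (J 0 \<nu>) x + -1 * ?B)) UNIV"
    by (intro has_sum_add has_sum_cmult_right has_sum_Pop def has_sum_D_part)
  then have "((\<lambda>y. if y \<in> kids x then c 0 x * \<nu> y else 0) has_sum (Pop p (J 0 \<nu>) x - ?B)) UNIV"
    by (simp add: p_J_split)
  moreover have "Pop p (J 0 \<nu>) x - ?B = c 0 x * \<nu> x"
    using Lop_D_part[of 0 \<nu> x] harm[of x] by (simp add: Lop_def)
  ultimately have "((\<lambda>y. c 0 x * \<nu> y) has_sum (c 0 x * \<nu> x)) (kids x)"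
    by (simp add: has_sum_kids_part)
  then show "(\<nu> has_sum \<nu> x) (kids x)"
    using c_nonzero by (simp add: has_sum_cmult_right_iff)
qed

text \<open>The equation at \<open>x\<close> involves \<nu> only at ancestors of \<open>x\<close>,
  with a nonzero coefficient at \<open>x\<close> itself. It is solved by recursion on the length of
  the geodesic.\<close>

lemma J_0_surj: "\<exists>\<nu>. \<forall>x. J 0 \<nu> x = f x"
proof -
  let ?P = "\<lambda>\<nu> x a. (\<Sum>z\<in>anc x - {x}. D 0 z x * \<nu> z) + D 0 x x * a = f x"
  have shorter: "length (path z) < length (path x)" if z: "z \<in> anc x - {x}" for x z
  proof -
    obtain as bs where x: "path x = as @ z # bs"
      using z split_list[of z "path x"] by blast
    then have "path z = as @ [z]" "bs \<noteq> []"
      using path_prefix path_facts(5)[of x] z by auto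
    then show ?thesis
      by (simp add: x)
  qed
  have "\<exists>\<nu>. \<forall>x. ?P \<nu> x (\<nu> x)"
  proof (rule dependent_wf_choice[of "Wellfounded.measure (\<lambda>x. length (path x))"])
    show "?P \<nu> x a = ?P \<mu> x a" if "\<And>z. (z, x) \<in> Wellfounded.measure (\<lambda>x. length (path x)) \<Longrightarrow> \<nu> z = \<mu> z" for \<nu> \<mu> x a
      using that shorter by (auto intro!: arg_cong2[where f = "(=)"] arg_cong2[where f = "(+)"] sum.cong)
    show "\<exists>a. ?P \<nu> x a" for \<nu> x
      using D_diagonal_nonzero[of x]
      by (intro exI[of _ "(f x - (\<Sum>z\<in>anc x - {x}. D 0 z x * \<nu> z)) / D 0 x x"]) simp
  qed simp
  moreover have "J 0 \<nu> x = (\<Sum>z\<in>anc x - {x}. D 0 z x * \<nu> z) + D 0 x x * \<nu> x" for \<nu> x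
    unfolding J_def by (subst sum.remove[of "anc x" x]) (auto simp: self_in_anc)
  ultimately show ?thesis
    by simp
qed

lemma J_0_inj:
  assumes "\<And>x. J 0 \<nu> x = J 0 \<mu> x"
  shows "\<nu> = \<mu>"
proof
  have "\<forall>z\<in>anc x. \<nu> z = \<mu> z" for x
  proof (induction x rule: tree_induct)
    case root
    then show ?case
      using assms[of rt] D_diagonal_nonzero[of rt] by (simp add: J_def anc_root)
  next
    case (child x y)
    then have "\<nu> y = \<mu> y"
      using assms[of y] D_diagonal_nonzero[of y] kids_not_anc[of y x]
      by (simp add: J_def kids_anc[of y x])
    then show ?case
      using child by (simp add: kids_anc)
  qed
  then show "\<nu> x = \<mu> x" for x
    using self_in_anc by blast
qed

section \<open>Induction on the order\<close>

definition Jsum :: "nat \<Rightarrow> (nat \<Rightarrow> 'v \<Rightarrow> complex) \<Rightarrow> 'v \<Rightarrow> complex" where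
  "Jsum n \<nu> x = (\<Sum>r<n. J r (\<nu> r) x)"

text \<open>The action of \<open>\<lambda>I - P\<close> on the family of distributions: the entry of
  index 0 is lost, and every other entry moves down one index with the factor produced by
  differentiation.\<close>

definition shift :: "(nat \<Rightarrow> 'v \<Rightarrow> complex) \<Rightarrow> nat \<Rightarrow> 'v \<Rightarrow> complex" where
  "shift \<nu> r x = - of_nat (Suc r) * \<nu> (Suc r) x"

lemma J_cmult: "J r (\<lambda>x. a * \<nu> x) x = a * J r \<nu> x"
  by (simp add: J_def sum_distrib_left mult_ac)

lemma Jsum_Suc: "Jsum (Suc n) \<nu> x = J 0 (\<nu> 0) x + (\<Sum>r<n. J (Suc r) (\<nu> (Suc r)) x)"
  unfolding Jsum_def by (rule sum.lessThan_Suc_shift)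

lemma
  assumes "\<And>r. r < n \<Longrightarrow> cdist adj rt (\<nu> (Suc r))"
  shows Pdefined_tail: "Pdefined p (\<lambda>x. \<Sum>r<n. J (Suc r) (\<nu> (Suc r)) x)"
    and Lop_tail: "Lop p lam (\<lambda>x. \<Sum>r<n. J (Suc r) (\<nu> (Suc r)) x) x = Jsum n (shift \<nu>) x"
proof -
  show "Pdefined p (\<lambda>x. \<Sum>r<n. J (Suc r) (\<nu> (Suc r)) x)"
    using assms by (intro Pdefined_sum Pdefined_J) auto
  have "Lop p lam (\<lambda>x. \<Sum>r<n. J (Suc r) (\<nu> (Suc r)) x) x = (\<Sum>r<n. Lop p lam (J (Suc r) (\<nu> (Suc r))) x)"
    using assms by (intro Lop_sum Pdefined_J) auto
  also have "\<dots> = Jsum n (shift \<nu>) x"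
    unfolding Jsum_def shift_def[abs_def] J_cmult
    using assms by (intro sum.cong) (auto simp: Lop_J simp del: of_nat_Suc)
  finally show "Lop p lam (\<lambda>x. \<Sum>r<n. J (Suc r) (\<nu> (Suc r)) x) x = Jsum n (shift \<nu>) x" .
qed

lemma
  assumes "\<And>r. r < Suc n \<Longrightarrow> cdist adj rt (\<nu> r)"
  shows Pdefined_Jsum: "Pdefined p (Jsum (Suc n) \<nu>)"
    and Lop_Jsum: "Lop p lam (Jsum (Suc n) \<nu>) = Jsum n (shift \<nu>)"
proof -
  have eq: "Jsum (Suc n) \<nu> = (\<lambda>x. J 0 (\<nu> 0) x + (\<Sum>r<n. J (Suc r) (\<nu> (Suc r)) x))"
    by (rule ext) (rule Jsum_Suc)
  show "Pdefined p (Jsum (Suc n) \<nu>)"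
    unfolding eq using assms by (intro Pdefined_add Pdefined_J Pdefined_tail) auto
  show "Lop p lam (Jsum (Suc n) \<nu>) = Jsum n (shift \<nu>)"
    unfolding eq using assms
    by (intro ext) (simp add: Lop_add Pdefined_J Pdefined_tail Lop_tail Lop_J)
qed

lemma cdist_shift:
  "(\<And>r. r < Suc n \<Longrightarrow> cdist adj rt (\<nu> r)) \<Longrightarrow> r < n \<Longrightarrow> cdist adj rt (shift \<nu> r)"
  unfolding shift_def[abs_def] by (intro cdist_cmult) auto

lemma polyharmonic_Jsum:
  "(\<And>r. r < n \<Longrightarrow> cdist adj rt (\<nu> r)) \<Longrightarrow> polyharmonic p lam n (Jsum n \<nu>)"
proof (induction n arbitrary: \<nu>)
  case 0
  then show ?case
    by (simp add: polyharmonic_0 Jsum_def fun_eq_iff)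
next
  case (Suc n)
  have "polyharmonic p lam n (Jsum n (shift \<nu>))"
    by (rule Suc.IH) (rule cdist_shift[OF Suc.prems])
  then show ?case
    using Suc.prems by (simp add: polyharmonic_Suc Pdefined_Jsum Lop_Jsum)
qed

text \<open>The function \<open>(\<lambda>I - P) f\<close> is represented by induction. The entries
  of positive index are chosen to have the same image, and the difference is harmonic, so it
  supplies the entry of index 0.\<close>

lemma polyharmonic_imp_Jsum:
  "polyharmonic p lam n f \<Longrightarrow> \<exists>\<nu>. (\<forall>r<n. cdist adj rt (\<nu> r)) \<and> f = Jsum n \<nu>"
proof (induction n arbitrary: f)
  case 0
  then show ?case
    by (simp add: polyharmonic_0 Jsum_def fun_eq_iff)
next
  case (Suc n)
  then have f: "Pdefined p f" "polyharmonic p lam n (Lop p lam f)"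
    by (auto simp: polyharmonic_Suc)
  then obtain \<nu> where \<nu>: "\<forall>r<n. cdist adj rt (\<nu> r)" "Lop p lam f = Jsum n \<nu>"
    using Suc.IH by blast
  \<comment> \<open>This inverts \<open>shift\<close> on positive indices. Division by zero makes
    \<open>\<mu> 0\<close> vanish; the harmonic remainder replaces it in \<rho>.\<close>
  define \<mu> where "\<mu> r = (\<lambda>x. - (1 / of_nat r) * \<nu> (r - 1) x)" for r
  have shift: "shift \<mu> = \<nu>"
    by (auto simp: fun_eq_iff shift_def \<mu>_def simp del: of_nat_Suc)
  have \<mu>: "cdist adj rt (\<mu> (Suc r))" if "r < n" for r
    using \<nu> that unfolding \<mu>_def by (intro cdist_cmult) auto
  define g where "g x = f x - (\<Sum>r<n. J (Suc r) (\<mu> (Suc r)) x)" for x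
  have "Pdefined p g"
    unfolding g_def[abs_def] by (intro Pdefined_diff f Pdefined_tail \<mu>)
  have "Lop p lam g x = 0" for x
    unfolding g_def[abs_def] by (simp add: Lop_diff f Pdefined_tail Lop_tail \<mu> \<nu> shift)
  obtain \<kappa> where \<kappa>: "\<And>x. J 0 \<kappa> x = g x"
    using J_0_surj by metis
  then have "J 0 \<kappa> = g"
    by blast
  then have "cdist adj rt \<kappa>"
    using \<open>Pdefined p g\<close> \<open>\<And>x. Lop p lam g x = 0\<close> cdist_if_J_harmonic by metis
  define \<rho> where "\<rho> r = (if r = 0 then \<kappa> else \<mu> r)" for r
  have "cdist adj rt (\<rho> r)" if "r < Suc n" for r
    using that \<mu>[of "r - 1"] \<open>cdist adj rt \<kappa>\<close> by (auto simp: \<rho>_def)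
  moreover have "f = Jsum (Suc n) \<rho>"
    by (rule ext) (simp add: Jsum_Suc \<rho>_def \<kappa> g_def)
  ultimately show ?case
    by blast
qed

text \<open>Applying \<open>\<lambda>I - P\<close> and the induction hypothesis fixes the entries of
  positive index. Cancelling them leaves two order-one sums, where \<open>J 0\<close> is
  injective.\<close>

lemma Jsum_inj:
  "(\<And>r. r < n \<Longrightarrow> cdist adj rt (\<nu> r)) \<Longrightarrow> (\<And>r. r < n \<Longrightarrow> cdist adj rt (\<mu> r)) \<Longrightarrow>
    Jsum n \<nu> = Jsum n \<mu> \<Longrightarrow> r < n \<Longrightarrow> \<nu> r = \<mu> r"
proof (induction n arbitrary: \<nu> \<mu> r)
  case (Suc n)
  have "Jsum n (shift \<nu>) = Jsum n (shift \<mu>)"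
    using Lop_Jsum[of n \<nu>] Lop_Jsum[of n \<mu>] Suc.prems by metis
  then have "shift \<nu> r = shift \<mu> r" if "r < n" for r
    using Suc.IH[of "shift \<nu>" "shift \<mu>"] cdist_shift Suc.prems that by blast
  then have tail: "\<nu> (Suc r) = \<mu> (Suc r)" if "r < n" for r
    using that by (auto simp: fun_eq_iff shift_def simp del: of_nat_Suc)
  have "J 0 (\<nu> 0) x = J 0 (\<mu> 0) x" for x
    using Suc.prems(3) Jsum_Suc[of n \<nu> x] Jsum_Suc[of n \<mu> x] tail by simp
  then have "\<nu> 0 = \<mu> 0"
    by (rule J_0_inj)
  then show ?case
    using tail Suc.prems(4) by (cases r) auto
qed simp

end

section \<open>Green functions on trees\<close>

lemma higher_deriv_power_series:
  fixes f :: "complex \<Rightarrow> complex"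
  assumes "r > 0" and sums: "\<And>w. w \<in> ball z r \<Longrightarrow> (\<lambda>n. a n * (w - z) ^ n) sums f w"
  shows "(deriv ^^ n) f z = fact n * a n"
proof -
  have "eventually (\<lambda>u. u \<in> ball 0 r) (nhds (0 :: complex))"
    using \<open>r > 0\<close> by (intro eventually_nhds_in_open) auto
  then have "(f \<circ> (\<lambda>u. z + u)) has_fps_expansion Abs_fps a"
    by (intro has_fps_expansionI, eventually_elim) (use sums[of "z + _"] in \<open>auto simp: dist_norm\<close>)
  then have "a n = (deriv ^^ n) (f \<circ> (\<lambda>u. z + u)) 0 / fact n"
    using fps_nth_fps_expansion[of "f \<circ> (\<lambda>u. z + u)" "Abs_fps a" n] by simp
  then show ?thesis
    by (simp add: higher_deriv_shift_0[of n f z])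
qed

lemma zip_tl_snoc: "xs \<noteq> [] \<Longrightarrow> zip (xs @ [y]) (tl xs @ [y]) = zip xs (tl xs) @ [(last xs, y)]"
proof (induction xs)
  case (Cons x xs)
  then show ?case
    by (cases xs) auto
qed simp

locale tree_walk = rooted_tree adj rt for adj :: "'v \<Rightarrow> 'v \<Rightarrow> bool" and rt +
  fixes p :: "'v \<Rightarrow> 'v \<Rightarrow> real"
  assumes sto: "stochastic adj p"
begin

lemma p_pos: "adj x y \<Longrightarrow> p x y > 0"
  using sto by (simp add: stochastic_def)

lemma p_zero: "\<not> adj x y \<Longrightarrow> p x y = 0"
  using sto by (metis less_eq_real_def stochastic_def)

lemma mfun_kid: "y \<in> kids x \<Longrightarrow> mfun adj p rt y = mfun adj p rt x * (p x y / p y x)"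
  using path_facts[of x] by (simp add: mfun_def Let_def kids_iff zip_tl_snoc)

lemma mfun_pos: "mfun adj p rt x > 0"
proof (induction x rule: tree_induct)
  case root
  then show ?case
    by (simp add: mfun_def path_root)
next
  case (child x y)
  then have "p x y > 0" "p y x > 0"
    using p_pos adj_iff by auto
  then show ?case
    using child by (simp add: mfun_kid)
qed

lemma mfun_balance: "mfun adj p rt x * p x y = mfun adj p rt y * p y x"
proof -
  have *: "mfun adj p rt x * p x y = mfun adj p rt y * p y x" if "y \<in> kids x" for x y
    using that p_pos[of y x] adj_iff by (auto simp: mfun_kid)
  show ?thesis
    using *[of x y] *[of y x] adj_iff[of x y] adj_iff[of y x] p_zero[of x y] p_zero[of y x]
    by auto
qed

sublocale reversible_kernel p "mfun adj p rt"
  using sto mfun_pos mfun_balance by unfold_locales (auto simp: stochastic_def)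

lemma l2m_eq_wl2: "l2m adj p rt = wl2"
  by (simp add: l2m_def wl2_def)

abbreviation unit :: "'v \<Rightarrow> 'v \<Rightarrow> complex" where
  "unit y \<equiv> \<lambda>x. if x = y then 1 else 0"

abbreviation G :: "complex \<Rightarrow> 'v \<Rightarrow> 'v \<Rightarrow> complex" where
  "G \<equiv> green adj p rt"

text \<open>Unique solvability for point masses is what gives the \<open>THE\<close> in
  \<open>green\<close> its meaning. It is available at every \<mu> near \<open>lam\<close>.\<close>

definition solvable :: "complex \<Rightarrow> bool" where
  "solvable \<mu> \<longleftrightarrow> (\<forall>y. \<exists>!f. f \<in> wl2 \<and> Lop p \<mu> f = unit y)"

lemma
  assumes "solvable \<mu>"
  shows green_in_wl2: "(\<lambda>x. G \<mu> x y) \<in> wl2"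
    and Lop_green: "Lop p \<mu> (\<lambda>x. G \<mu> x y) = unit y"
    and green_unique: "f \<in> wl2 \<Longrightarrow> Lop p \<mu> f = unit y \<Longrightarrow> f = (\<lambda>x. G \<mu> x y)"
proof -
  have ex1: "\<exists>!f. f \<in> wl2 \<and> Lop p \<mu> f = unit y"
    using assms unfolding solvable_def by (rule spec)
  have eq: "(\<lambda>x. G \<mu> x y) = (THE f. f \<in> wl2 \<and> Lop p \<mu> f = unit y)"
    unfolding green_def l2m_eq_wl2 ..
  show "(\<lambda>x. G \<mu> x y) \<in> wl2" "Lop p \<mu> (\<lambda>x. G \<mu> x y) = unit y"
    unfolding eq using theI'[OF ex1] by auto
  show "f \<in> wl2 \<Longrightarrow> Lop p \<mu> f = unit y \<Longrightarrow> f = (\<lambda>x. G \<mu> x y)"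
    unfolding eq using the1_equality[OF ex1] by auto
qed

lemma eq_green_cmult:
  assumes "solvable \<mu>" "h \<in> wl2" "\<And>x. Lop p \<mu> h x = (if x = y then a else 0)"
  shows "h x = a * G \<mu> x y"
proof -
  let ?g = "\<lambda>x. G \<mu> x y"
  have g: "?g \<in> wl2" "\<And>x. Lop p \<mu> ?g x = unit y x"
    using green_in_wl2 Lop_green assms by auto
  \<comment> \<open>Adding this multiple of the Green function normalises the source to 1 without
    dividing by \<open>a\<close>, which may be 0.\<close>
  let ?f = "\<lambda>x. h x + (1 - a) * ?g x"
  have "?f \<in> wl2"
    by (intro wl2_add wl2_cmult assms g)
  moreover have "Lop p \<mu> ?f = unit y"
    by (rule ext) (auto simp: Lop_add Lop_cmult Pdefined_wl2 wl2_cmult assms(2,3) g)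
  ultimately have "?f = ?g"
    using green_unique[OF assms(1)] by blast
  then have "?f x = ?g x"
    by (rule fun_cong)
  then show ?thesis
    by (simp add: algebra_simps)
qed

text \<open>Cutting a function off at the edge between \<open>v\<close> and its parent only changes \<open>\<mu>I - P\<close> at the
  two endpoints of this edge.\<close>

lemma Lop_cut:
  fixes u :: "'v \<Rightarrow> complex"
  assumes u: "u \<in> wl2" and v: "v \<noteq> rt"
  defines "h \<equiv> \<lambda>x. if v \<notin> anc x then u x else 0"
  shows "Lop p \<mu> h x = (if v \<notin> anc x then Lop p \<mu> u x else 0)
    + (if x = par v then p x v * u v else 0) - (if x = v then p v (par v) * u (par v) else 0)"
proof -
  define w where "w = par v"
  have w: "v \<in> kids w" "v \<notin> anc w" "w \<noteq> v" "v \<in> anc v"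
    using kids_par[OF v] par_not_below[OF v] self_in_anc by (auto simp: w_def)
  \<comment> \<open>On either side of the cut the rows agree. Across the edge, a term is removed
    when \<open>x = w\<close>, and a compensating term is listed when \<open>x = v\<close>.\<close>
  have split: "complex_of_real (p x y) * h y = (if v \<notin> anc x then complex_of_real (p x y) * u y else 0)
      + ((if y = v then (if x = w then - (p x v * u v) else 0) else 0)
      + (if y = w then (if x = v then p v w * u w else 0) else 0))" for y
  proof (cases "adj x y")
    case True
    show ?thesis
    proof (cases "v \<in> anc x \<longleftrightarrow> v \<in> anc y")
      case True
      then show ?thesis
        using w by (auto simp: h_def)
    next
      case False
      then consider "x = v" "y = w" | "y = v" "x = w"
        using cut_edge[of x y v] cut_edge[of y x v] True adj_sym unfolding w_def by blast
      then show ?thesis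
        by cases (use w in \<open>auto simp: h_def\<close>)
    qed
  next
    case False
    then show ?thesis
      using w adj_iff[of v w] adj_iff[of w v] p_zero[of x y] by auto
  qed
  have delta: "((\<lambda>y. if y = b then c else 0) has_sum c) UNIV" for b :: 'v and c :: complex
    by (intro has_sum_finite_neutralI[of "{b}"]) auto
  have "((\<lambda>y. if v \<notin> anc x then complex_of_real (p x y) * u y else 0)
      has_sum (if v \<notin> anc x then Pop p u x else 0)) UNIV"
    using has_sum_Pop[OF Pdefined_wl2[OF u], of x] by simp
  then have "((\<lambda>y. complex_of_real (p x y) * h y) has_sum (if v \<notin> anc x then Pop p u x else 0)
      + ((if x = w then - (p x v * u v) else 0) + (if x = v then p v w * u w else 0))) UNIV"
    unfolding split by (intro has_sum_add delta)
  then have "Pop p h x = (if v \<notin> anc x then Pop p u x else 0)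
      + ((if x = w then - (p x v * u v) else 0) + (if x = v then p v w * u w else 0))"
    by (rule Pop_eqI)
  then show ?thesis
    unfolding Lop_def w_def[symmetric] using w by (auto simp: h_def)
qed

text \<open>The combination \<open>u\<close> vanishes at the parent \<open>w\<close>. Restricted to
  the complement of the branch at \<open>v\<close>, it has its source only at \<open>w\<close>, so
  it is a multiple of \<open>G(., w)\<close>; evaluation at \<open>w\<close> forces the multiple to
  be 0.\<close>

lemma green_through_parent:
  assumes \<mu>: "solvable \<mu>" and v: "v \<noteq> rt" and nz: "G \<mu> (par v) (par v) \<noteq> 0" and x: "v \<notin> anc x"
  shows "G \<mu> x v * G \<mu> (par v) (par v) = G \<mu> x (par v) * G \<mu> (par v) v"
proof -
  define w where "w = par v"
  have w: "v \<notin> anc w" "w \<noteq> v" "v \<in> anc v"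
    using kids_par[OF v] par_not_below[OF v] self_in_anc by (auto simp: w_def)
  define u where "u x = G \<mu> w w * G \<mu> x v - G \<mu> w v * G \<mu> x w" for x
  have u: "u \<in> wl2"
    unfolding u_def by (intro wl2_diff wl2_cmult green_in_wl2 \<mu>)
  have Lu: "Lop p \<mu> u x = G \<mu> w w * unit v x - G \<mu> w v * unit w x" for x
    unfolding u_def[abs_def]
    by (subst Lop_diff) (auto simp: Lop_cmult Lop_green \<mu> intro!: Pdefined_wl2 wl2_cmult green_in_wl2)
  define h where "h x = (if v \<notin> anc x then u x else 0)" for x
  \<comment> \<open>The source of \<open>u\<close> at \<open>w\<close> plus the contribution of
    \<open>v\<close> removed by the cut. The correction at \<open>v\<close> is 0 because
    \<open>u w = 0\<close>.\<close>
  define a where "a = p w v * u v - G \<mu> w v"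
  have uw: "u w = 0"
    by (simp add: u_def)
  have h: "h \<in> wl2"
    using wl2_restrict[OF u, of "{x. v \<notin> anc x}"] by (simp add: h_def[abs_def])
  have "Lop p \<mu> h x = (if x = w then a else 0)" for x
    unfolding h_def[abs_def] Lop_cut[OF u v] Lu w_def[symmetric] uw a_def using w by auto
  then have h_eq: "h x = a * G \<mu> x w" for x
    by (rule eq_green_cmult[OF \<mu> h])
  have "a * G \<mu> w w = 0"
    using h_eq[of w] w uw by (simp add: h_def)
  then have "h x = 0"
    using nz h_eq by (simp add: w_def)
  then show ?thesis
    using x by (simp add: h_def u_def w_def mult.commute)
qed

text \<open>If \<open>G(w, v)\<close> were 0, cutting \<open>G(., v)\<close> at the edge would leave
  a source of size \<open>p w v * G(v, v)\<close> at \<open>w\<close> alone. The value at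
  \<open>w\<close> would then be \<open>p w v * G(v, v) * G(w, w)\<close>, a nonzero number equal to
  0.\<close>

lemma green_parent_nonzero:
  assumes \<mu>: "solvable \<mu>" and v: "v \<noteq> rt" and nz: "\<And>x. G \<mu> x x \<noteq> 0"
  shows "G \<mu> (par v) v \<noteq> 0"
proof
  define w where "w = par v"
  assume "G \<mu> (par v) v = 0"
  then have 0: "G \<mu> w v = 0"
    by (simp add: w_def)
  have w: "v \<in> kids w" "v \<notin> anc w" "w \<noteq> v" "v \<in> anc v"
    using kids_par[OF v] par_not_below[OF v] self_in_anc by (auto simp: w_def)
  define h where "h x = (if v \<notin> anc x then G \<mu> x v else 0)" for x
  have u: "(\<lambda>x. G \<mu> x v) \<in> wl2"
    by (rule green_in_wl2[OF \<mu>])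
  have h: "h \<in> wl2"
    using wl2_restrict[OF u, of "{x. v \<notin> anc x}"] by (simp add: h_def[abs_def])
  have "Lop p \<mu> h x = (if x = w then p w v * G \<mu> v v else 0)" for x
    unfolding h_def[abs_def] Lop_cut[OF u v] Lop_green[OF \<mu>] w_def[symmetric] 0 using w by auto
  then have "h w = p w v * G \<mu> v v * G \<mu> w w"
    by (rule eq_green_cmult[OF \<mu> h])
  then show False
    using w 0 nz p_pos[of w v] adj_iff[of w v] by (auto simp: h_def)
qed

text \<open>The factorisation \<open>G(rt, y) G(x, x) = G(rt, x) G(x, y)\<close> carries
  nonvanishing from \<open>x\<close> to its child \<open>y\<close>.\<close>

lemma green_root_nonzero:
  assumes \<mu>: "solvable \<mu>" and nz: "\<And>x. G \<mu> x x \<noteq> 0"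
  shows "G \<mu> rt v \<noteq> 0"
proof (induction v rule: tree_induct)
  case root
  then show ?case
    by (rule nz)
next
  case (child x y)
  have y: "y \<noteq> rt" "par y = x" "y \<notin> anc rt"
    using kids_ne_root[OF child(1)] kids_imp_par[OF child(1)] by (auto simp: anc_root)
  have "G \<mu> rt y * G \<mu> x x = G \<mu> rt x * G \<mu> x y"
    using green_through_parent[OF \<mu> y(1) nz y(3)] y by simp
  moreover have "G \<mu> x y \<noteq> 0"
    using green_parent_nonzero[OF \<mu> y(1) nz] y by simp
  ultimately show ?case
    using child nz by force
qed

end

section \<open>Derivatives in the spectral parameter and the kernel representation\<close>

locale resolvent_walk = tree_walk adj rt p for adj :: "'v \<Rightarrow> 'v \<Rightarrow> bool" and rt p +
  fixes lam :: complex
  assumes lam: "lam \<in> resP_star adj p rt"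
begin

definition c :: "nat \<Rightarrow> 'v \<Rightarrow> complex" where
  "c r v = (deriv ^^ r) (\<lambda>\<mu>. 1 / G \<mu> rt v) lam"

definition kd :: "nat \<Rightarrow> 'v \<Rightarrow> 'v \<Rightarrow> complex" where
  "kd r v x = (deriv ^^ r) (\<lambda>\<mu>. G \<mu> x v / G \<mu> rt v) lam"

definition gd :: "nat \<Rightarrow> 'v \<Rightarrow> 'v \<Rightarrow> complex" where
  "gd r v x = (deriv ^^ r) (\<lambda>\<mu>. G \<mu> x v) lam"

text \<open>By the expansion at \<open>lam\<close>, \<open>gd r v\<close> is
  \<open>(-1)^r r!\<close> times the resolvent applied \<open>r + 1\<close> times to the point mass
  at \<open>v\<close>. This gives membership in \<open>wl2\<close> and the recursion under
  \<open>lam I - P\<close>.\<close>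

lemma green_near_lam:
  obtains \<delta> where "\<delta> > 0" "\<And>\<mu>. \<mu> \<in> ball lam \<delta> \<Longrightarrow> solvable \<mu>"
    "\<And>x y. (\<lambda>\<mu>. G \<mu> x y) holomorphic_on ball lam \<delta>"
    "\<And>r v. gd r v \<in> wl2"
    "\<And>r v x. Lop p lam (gd r v) x = (if r = 0 then unit v x else - of_nat r * gd (r - 1) v x)"
proof -
  have res: "\<exists>!f. f \<in> wl2 \<and> Lop p lam f = g" if "g \<in> wl2" for g
    using lam that unfolding resP_star_def resP_def l2m_eq_wl2 by blast
  obtain \<delta> where \<delta>: "\<delta> > 0" and exp: "\<forall>g\<in>wl2. \<exists>w. resolvent_coeffs lam \<delta> g w"
    using resolvent_expansion[OF res] by blast
  have "\<exists>w. \<forall>y. resolvent_coeffs lam \<delta> (unit y) (w y)"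
    using exp wl2_indicator by (intro choice allI) blast
  then obtain w where coeffs: "\<And>y. resolvent_coeffs lam \<delta> (unit y) (w y)"
    by blast
  have w: "w y k \<in> wl2" "Lop p lam (w y 0) = unit y" "Lop p lam (w y (Suc k)) = w y k" for y k
    using coeffs[of y] by (simp_all add: resolvent_coeffs_def)
  have ex: "\<exists>f\<in>wl2. Lop p \<mu> f = unit y" if "\<mu> \<in> ball lam \<delta>" for \<mu> y
    using coeffs[of y] that unfolding resolvent_coeffs_def by blast
  have sums: "(\<lambda>k. (lam - \<mu>) ^ k * w y k x) sums f x"
    if "\<mu> \<in> ball lam \<delta>" "f \<in> wl2" "Lop p \<mu> f = unit y" for \<mu> f y x
    using coeffs[of y] that unfolding resolvent_coeffs_def by blast
  have solvable: "solvable \<mu>" if \<mu>: "\<mu> \<in> ball lam \<delta>" for \<mu>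
    unfolding solvable_def
  proof
    fix y
    obtain f where f: "f \<in> wl2" "Lop p \<mu> f = unit y"
      using ex[OF \<mu>] by blast
    show "\<exists>!f. f \<in> wl2 \<and> Lop p \<mu> f = unit y"
    proof (rule ex1I[of _ f])
      show "f \<in> wl2 \<and> Lop p \<mu> f = unit y"
        using f ..
      show "h = f" if "h \<in> wl2 \<and> Lop p \<mu> h = unit y" for h
        by (rule ext) (rule sums_unique2[OF sums[OF \<mu> that[THEN conjunct1] that[THEN conjunct2]] sums[OF \<mu> f]])
    qed
  qed
  have G_sums: "(\<lambda>k. ((-1) ^ k * w y k x) * (\<mu> - lam) ^ k) sums G \<mu> x y" if "\<mu> \<in> ball lam \<delta>" for \<mu> x y
  proof -
    have "(\<lambda>k. (lam - \<mu>) ^ k * w y k x) sums G \<mu> x y"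
      using sums[OF that green_in_wl2 Lop_green] solvable[OF that] by blast
    moreover have "(lam - \<mu>) ^ k = (-1) ^ k * (\<mu> - lam) ^ k" for k
      by (simp flip: power_mult_distrib)
    ultimately show ?thesis
      by (simp add: mult_ac)
  qed
  have hol: "(\<lambda>\<mu>. G \<mu> x y) holomorphic_on ball lam \<delta>" for x y
    using G_sums by (rule power_series_holomorphic)
  have gd: "gd r v = (\<lambda>x. fact r * (-1) ^ r * w v r x)" for r v
    unfolding gd_def using higher_deriv_power_series[OF \<delta> G_sums] by (auto simp: mult_ac)
  have "gd r v \<in> wl2" for r v
    unfolding gd by (intro wl2_cmult w)
  moreover have "Lop p lam (gd r v) x = (if r = 0 then unit v x else - of_nat r * gd (r - 1) v x)" for r v x
    unfolding gd Lop_cmult by (cases r) (auto simp: w algebra_simps)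
  ultimately show thesis
    using that \<delta> solvable hol by blast
qed

lemma green_diagonal_nonzero: "G lam x x \<noteq> 0"
  using lam by (simp add: resP_star_def)

text \<open>Leibniz rule on a neighbourhood of \<open>lam\<close> where \<open>G(rt, v)\<close> has
  no zero. It writes \<open>kd r v\<close> as a finite combination of elements of
  \<open>wl2\<close>, to which \<open>lam I - P\<close> applies termwise.\<close>

lemma kd_product:
  "kd r v = (\<lambda>x. \<Sum>i = 0..r. (of_nat (r choose i) * c (r - i) v) * gd i v x)"
proof -
  obtain \<delta> where \<delta>: "\<delta> > 0" "\<And>\<mu>. \<mu> \<in> ball lam \<delta> \<Longrightarrow> solvable \<mu>"
    and hol: "\<And>x y. (\<lambda>\<mu>. G \<mu> x y) holomorphic_on ball lam \<delta>"
    using green_near_lam by metis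
  define S where "S = ball lam \<delta> \<inter> (\<lambda>\<mu>. G \<mu> rt v) -` (- {0})"
  have "open S"
    unfolding S_def using hol by (intro continuous_open_preimage holomorphic_on_imp_continuous_on) auto
  have "lam \<in> S"
    using \<delta> green_root_nonzero[OF \<delta>(2) green_diagonal_nonzero] by (simp add: S_def)
  have holS: "(\<lambda>\<mu>. G \<mu> x v) holomorphic_on S" for x
    using hol by (rule holomorphic_on_subset) (auto simp: S_def)
  have "(\<lambda>\<mu>. 1 / G \<mu> rt v) holomorphic_on S"
    using hol[of rt v] by (intro holomorphic_intros holomorphic_on_subset[OF hol[of rt v]]) (auto simp: S_def)
  then have "kd r v x = (\<Sum>i = 0..r. of_nat (r choose i) * gd i v x * c (r - i) v)" for x
    using higher_deriv_mult[OF holS[of x] _ \<open>open S\<close> \<open>lam \<in> S\<close>, of "\<lambda>\<mu>. 1 / G \<mu> rt v" r]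
    by (simp add: kd_def gd_def c_def)
  then show ?thesis
    by (auto simp: fun_eq_iff mult_ac)
qed

end

sublocale resolvent_walk \<subseteq> kernel_tree adj rt p lam kd c
proof
  obtain \<delta> where \<delta>: "\<delta> > 0" "\<And>\<mu>. \<mu> \<in> ball lam \<delta> \<Longrightarrow> solvable \<mu>"
    and hol: "\<And>x y. (\<lambda>\<mu>. G \<mu> x y) holomorphic_on ball lam \<delta>"
    and gd: "\<And>r v. gd r v \<in> wl2"
      "\<And>r v x. Lop p lam (gd r v) x = (if r = 0 then unit v x else - of_nat r * gd (r - 1) v x)"
    using green_near_lam by blast
  have nz: "G lam rt v \<noteq> 0" for v
    using \<delta> green_root_nonzero[OF \<delta>(2) green_diagonal_nonzero] by simp
  have ev_nz: "eventually (\<lambda>\<mu>. G \<mu> x y \<noteq> 0) (nhds lam)" if "G lam x y \<noteq> 0" for x y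
  proof -
    have "isCont (\<lambda>\<mu>. G \<mu> x y) lam"
      using holomorphic_on_imp_continuous_on[OF hol[of x y]] \<delta>(1)
      by (simp add: continuous_on_eq_continuous_at)
    then have "((\<lambda>\<mu>. G \<mu> x y) \<longlongrightarrow> G lam x y) (nhds lam)"
      by (simp add: tendsto_nhds_iff isCont_def)
    then show ?thesis
      using that by (rule tendsto_imp_eventually_ne)
  qed
  fix r v x
  show "stochastic adj p"
    by (rule sto)
  show "kd r v x = kd r (par v) x" if v: "v \<noteq> rt" "v \<notin> anc x"
  proof -
    have "eventually (\<lambda>\<mu>. \<mu> \<in> ball lam \<delta>) (nhds lam)"
      using \<delta> by (intro eventually_nhds_in_open) auto
    \<comment> \<open>To compare derivatives, the quotients must agree on a neighbourhood of
      \<open>lam\<close>. By continuity the Green functions involved stay nonzero near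
      \<open>lam\<close>.\<close>
    then have "eventually (\<lambda>\<mu>. G \<mu> x v / G \<mu> rt v = G \<mu> x (par v) / G \<mu> rt (par v)) (nhds lam)"
      using ev_nz[OF green_diagonal_nonzero[of "par v"]] ev_nz[OF nz[of v]] ev_nz[OF nz[of "par v"]]
    proof eventually_elim
      case (elim \<mu>)
      have "G \<mu> x v * G \<mu> (par v) (par v) = G \<mu> x (par v) * G \<mu> (par v) v"
        "G \<mu> rt v * G \<mu> (par v) (par v) = G \<mu> rt (par v) * G \<mu> (par v) v"
        using green_through_parent[OF \<delta>(2)[OF elim(1)] v(1) elim(2)] v by (auto simp: anc_root)
      then have "G \<mu> x v * (G \<mu> rt (par v) * G \<mu> (par v) v) = G \<mu> rt v * (G \<mu> x (par v) * G \<mu> (par v) v)"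
        by (metis mult.assoc mult.commute)
      moreover have "G \<mu> (par v) v \<noteq> 0"
        using \<open>G \<mu> rt v * G \<mu> (par v) (par v) = G \<mu> rt (par v) * G \<mu> (par v) v\<close> elim by auto
      ultimately show ?case
        using elim by (simp add: field_simps)
    qed
    then show ?thesis
      unfolding kd_def by (intro higher_deriv_cong_ev) auto
  qed
  show "Pdefined p (kd r v)"
    unfolding kd_product by (intro Pdefined_wl2 wl2_sum wl2_cmult gd)
  show "Lop p lam (kd r v) x = (if x = v then c r v else 0) - of_nat r * kd (r - 1) v x"
  proof -
    have "Lop p lam (kd r v) x = (\<Sum>i = 0..r. (of_nat (r choose i) * c (r - i) v) * Lop p lam (gd i v) x)"
      unfolding kd_product by (subst Lop_sum) (auto simp: Lop_cmult intro!: Pdefined_wl2 wl2_cmult gd)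
    also have "\<dots> = (if x = v then c r v else 0) - of_nat r * kd (r - 1) v x"
    proof (cases r)
      case (Suc n)
      \<comment> \<open>The absorption identity
        \<open>(i+1) * binom(n+1, i+1) = (n+1) * binom(n, i)\<close> turns the shifted Leibniz sum
        into \<open>n + 1\<close> times the one for \<open>kd n v\<close>.\<close>
      have "of_nat (Suc n choose Suc i) * c (Suc n - Suc i) v * Lop p lam (gd (Suc i) v) x
          = - of_nat (Suc n) * (of_nat (n choose i) * c (n - i) v * gd i v x)" for i
      proof -
        have "(of_nat (Suc i) * of_nat (Suc n choose Suc i) :: complex) = of_nat (Suc n) * of_nat (n choose i)"
          unfolding of_nat_mult[symmetric] Suc_times_binomial ..
        then have "- (of_nat (Suc i) * of_nat (Suc n choose Suc i)) * (c (n - i) v * gd i v x)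
            = - (of_nat (Suc n) * of_nat (n choose i)) * (c (n - i) v * gd i v x)"
          by (simp only:)
        then show ?thesis
          by (simp add: gd(2) mult_ac del: of_nat_Suc binomial_Suc_Suc)
      qed
      then have "(\<Sum>i = 0..n. of_nat (Suc n choose Suc i) * c (Suc n - Suc i) v * Lop p lam (gd (Suc i) v) x)
          = - of_nat (Suc n) * kd n v x"
        unfolding kd_product[of n] sum_distrib_left by (intro sum.cong refl)
      then show ?thesis
        unfolding Suc sum.atLeast0_atMost_Suc_shift by (simp add: gd(2) del: of_nat_Suc binomial_Suc_Suc)
    qed (simp add: gd(2))
    finally show ?thesis .
  qed
  show "c 0 v \<noteq> 0"
    by (simp add: c_def nz)
  show "kd 0 rt rt \<noteq> 0"
    by (simp add: kd_def nz)
qed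

context resolvent_walk
begin

text \<open>The kernel depends on the end only through its confluent with \<open>x\<close>, so
  summation by parts applies with \<open>kd r z x\<close> as the value at confluent
  \<open>z\<close>.\<close>

lemma Krep_eq_Jsum:
  assumes "\<And>r. r < n \<Longrightarrow> cdist adj rt (\<nu> r)"
  shows "Krep adj p rt lam n \<nu> = Jsum n \<nu>"
proof
  fix x
  have "loc_integral adj rt (anc x) (Kderiv adj p rt r lam x) (\<nu> r) = J r (\<nu> r) x" if "r < n" for r
    unfolding J_def D_def
    by (rule loc_integral_path[OF assms[OF that]]) (simp add: Kderiv_def Kern_def kd_def)
  then show "Krep adj p rt lam n \<nu> x = Jsum n \<nu> x"
    by (simp add: Krep_def Jsum_def)
qed

end

theorem theorem5p3:
  fixes adj :: "'v::countable \<Rightarrow> 'v \<Rightarrow> bool"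
    and p :: "'v \<Rightarrow> 'v \<Rightarrow> real"
    and rt :: 'v
    and lam :: complex
    and n :: nat
  assumes "is_tree adj" and "no_leaves adj"
    and "stochastic adj p"
    and "lam \<in> resP_star adj p rt"
    and "n \<ge> 1"
  shows "(\<forall>f. polyharmonic p lam n f \<longrightarrow>
            (\<exists>\<nu>. (\<forall>r<n. cdist adj rt (\<nu> r)) \<and> (\<forall>x. f x = Krep adj p rt lam n \<nu> x)) \<and>
            (\<forall>\<nu> \<nu>'. (\<forall>r<n. cdist adj rt (\<nu> r)) \<and> (\<forall>x. f x = Krep adj p rt lam n \<nu> x) \<and>
                     (\<forall>r<n. cdist adj rt (\<nu>' r)) \<and> (\<forall>x. f x = Krep adj p rt lam n \<nu>' x)
                     \<longrightarrow> (\<forall>r<n. \<nu> r = \<nu>' r)))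
       \<and> (\<forall>\<nu>. (\<forall>r<n. cdist adj rt (\<nu> r)) \<longrightarrow> polyharmonic p lam n (Krep adj p rt lam n \<nu>))"
proof -
  interpret resolvent_walk adj rt p lam
    using assms by unfold_locales
  show ?thesis
  proof (intro conjI allI impI)
    fix f
    assume "polyharmonic p lam n f"
    then obtain \<nu> where "\<forall>r<n. cdist adj rt (\<nu> r)" "f = Jsum n \<nu>"
      using polyharmonic_imp_Jsum by blast
    then show "\<exists>\<nu>. (\<forall>r<n. cdist adj rt (\<nu> r)) \<and> (\<forall>x. f x = Krep adj p rt lam n \<nu> x)"
      using Krep_eq_Jsum by metis
  next
    fix f \<nu> \<nu>' r
    assume *: "(\<forall>r<n. cdist adj rt (\<nu> r)) \<and> (\<forall>x. f x = Krep adj p rt lam n \<nu> x) \<and>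
      (\<forall>r<n. cdist adj rt (\<nu>' r)) \<and> (\<forall>x. f x = Krep adj p rt lam n \<nu>' x)" and "r < n"
    then have "Krep adj p rt lam n \<nu> = Krep adj p rt lam n \<nu>'"
      by (intro ext) metis
    then have "Jsum n \<nu> = Jsum n \<nu>'"
      using * Krep_eq_Jsum[of n \<nu>] Krep_eq_Jsum[of n \<nu>'] by simp
    then show "\<nu> r = \<nu>' r"
      using Jsum_inj * \<open>r < n\<close> by blast
  next
    fix \<nu>
    assume "\<forall>r<n. cdist adj rt (\<nu> r)"
    then show "polyharmonic p lam n (Krep adj p rt lam n \<nu>)"
      using polyharmonic_Jsum Krep_eq_Jsum by simp
  qed
qed

end
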